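(* Let $\mathbb{F}$ be a finite field and $R$ be a finite ring. Then $|\mathbb{F}|$ and $|R|$ are relatively prime if and only if there exists a network $\mathcal{N}$ such that $\mathcal{C}_{lin}(\mathcal{N},R) > \mathcal{C}_{lin}(\mathcal{N},\mathbb{F})$.
   Context: Rings are associative with identity $1$, not necessarily commutative. Rings used as alphabets have at least two elements. A network is a finite directed acyclic multigraph, some of whose nodes are sources or receivers, with finitely many message vectors (say $m$ of them), each originating at a source node; each receiver demands a specified set of the message vectors. The inputs of a node are the message vectors originating at the node together with the vectors carried by its incoming edges. For integers $k_1,\dots,k_m\ge 0$ and $n\ge 1$, a $(k_1,\dots,k_m,n)$ code over a finite alphabet $\mathcal{A}$ (with $|\mathcal{A}|\ge 2$) lets the $i$th message vector range over $\mathcal{A}^{k_i}$, assigns to each edge an edge function mapping the inputs of the edge's tail node to a vector in $\mathcal{A}^n$ (the vector carried by the edge), and assigns to each receiver and each message vector it demands a decoding function of the receiver's inputs. The code is a solution if, for all values of the message vectors, each decoding function outputs the demanded message vector. Its rate vector is $(k_1/n,\dots,k_m/n)$. For a finite ring $R$, a code over the alphabet $R$ is two-sided linear if every component of every edge function and decoding function, as a function of the components $x_1,\dots,x_s\in R$ of the node's input vectors, has the form $\sum_{i=1}^{s}\sum_{j=1}^{n_i} a_{i,j}\,x_i\,b_{i,j}$ with $a_{i,j},b_{i,j}\in R$. (Equivalently, it is linear over $R$ viewed as a left module over $R\otimes_{\mathbb{Z}}R^{op}$ with $\left(\sum_i a_i\otimes b_i\right)\cdot x=\sum_i a_i x b_i$;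 for commutative $R$, in particular for a field, this is the same as ordinary linearity $\mathbf{x}\mapsto A\mathbf{x}$ with $A$ a matrix over $R$.) A rate vector $\mathbf{r}$ is linearly achievable for $\mathcal{N}$ over $R$ if $\mathcal{N}$ has a two-sided linear solution over $R$ (for some block sizes) with rate vector $\mathbf{r}$, and $\mathcal{C}_{lin}(\mathcal{N},R)=\sup\{r\in\mathbb{Q} : (r,\dots,r)\text{ is linearly achievable for }\mathcal{N}\text{ over }R\}$ (a supremum in the extended reals). *)

theory Defs
  imports Complex_Main "HOL-Library.FuncSet" "HOL-Library.Cardinality"
    "HOL-Library.Extended_Real" "Graph_Theory.Digraph"
begin

section \<open>Networks\<close>

text \<open>
  The messages of a network are numbered 0, ..., num_msgs - 1.  The node origin N i is
  the source node at which message i originates.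
\<close>

record ('v, 'e) network =
  graph :: "('v, 'e) pre_digraph"
  sources :: "'v set"
  receivers :: "'v set"
  num_msgs :: nat
  origin :: "nat \<Rightarrow> 'v"
  demand :: "'v \<Rightarrow> nat set"

definition is_network :: "('v, 'e) network \<Rightarrow> bool" where
  "is_network N \<longleftrightarrow>
     fin_digraph (graph N) \<and> acyclic (arcs_ends (graph N)) \<and>
     sources N \<subseteq> verts (graph N) \<and> receivers N \<subseteq> verts (graph N) \<and>
     (\<forall>i<num_msgs N. origin N i \<in> sources N) \<and>
     (\<forall>v\<in>receivers N. demand N v \<subseteq> {..<num_msgs N})"

text \<open>The things that carry a vector: message i, or an edge e.\<close>

datatype 'e channel = Msg nat | Arc 'e

definition inputs :: "('v, 'e) network \<Rightarrow> 'v \<Rightarrow> 'e channel set" where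
  "inputs N v = Msg ` {i. i < num_msgs N \<and> origin N i = v} \<union>
                Arc ` {e \<in> arcs (graph N). head (graph N) e = v}"


section \<open>Codes\<close>

text \<open>
  Vectors of length d over an alphabet, the latter given by a type, are lists of length d.
\<close>

definition vecs :: "nat \<Rightarrow> 'a list set" where
  "vecs d = {xs. length xs = d}"

primrec block_size :: "(nat \<Rightarrow> nat) \<Rightarrow> nat \<Rightarrow> 'e channel \<Rightarrow> nat" where
  "block_size k n (Msg i) = k i"
| "block_size k n (Arc e) = n"

definition input_space ::
    "('v, 'e) network \<Rightarrow> (nat \<Rightarrow> nat) \<Rightarrow> nat \<Rightarrow> 'v \<Rightarrow> ('e channel \<Rightarrow> 'a list) set" where
  "input_space N k n v = (\<Pi>\<^sub>E c\<in>inputs N v. vecs (block_size k n c))"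

record ('v, 'e, 'a) code =
  edge_fun :: "'e \<Rightarrow> ('e channel \<Rightarrow> 'a list) \<Rightarrow> 'a list"
  decode_fun :: "'v \<Rightarrow> nat \<Rightarrow> ('e channel \<Rightarrow> 'a list) \<Rightarrow> 'a list"

definition is_code ::
    "('v, 'e) network \<Rightarrow> (nat \<Rightarrow> nat) \<Rightarrow> nat \<Rightarrow> ('v, 'e, 'a) code \<Rightarrow> bool" where
  "is_code N k n C \<longleftrightarrow>
     (\<forall>e\<in>arcs (graph N). \<forall>x\<in>input_space N k n (tail (graph N) e). edge_fun C e x \<in> vecs n) \<and>
     (\<forall>v\<in>receivers N. \<forall>i\<in>demand N v. \<forall>x\<in>input_space N k n v. decode_fun C v i x \<in> vecs (k i))"

text \<open>
  An assignment w of vectors to messages and edges is propagated by a code if every edge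
  carries the value of its edge function at the inputs of its tail.  Since networks are
  finite and acyclic, the messages determine the vectors carried by the edges; see
  the lemmas ex_propagates and propagates_unique below.
\<close>

definition propagates ::
    "('v, 'e) network \<Rightarrow> ('v, 'e, 'a) code \<Rightarrow> ('e channel \<Rightarrow> 'a list) \<Rightarrow> bool" where
  "propagates N C w \<longleftrightarrow>
     (\<forall>e\<in>arcs (graph N).
        w (Arc e) = edge_fun C e (restrict w (inputs N (tail (graph N) e))))"

definition is_solution ::
    "('v, 'e) network \<Rightarrow> (nat \<Rightarrow> nat) \<Rightarrow> nat \<Rightarrow> ('v, 'e, 'a) code \<Rightarrow> bool" where
  "is_solution N k n C \<longleftrightarrow>
     is_code N k n C \<and>
     (\<forall>w. (\<forall>i<num_msgs N. w (Msg i) \<in> vecs (k i)) \<and> propagates N C w \<longrightarrow>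
        (\<forall>v\<in>receivers N. \<forall>i\<in>demand N v.
           decode_fun C v i (restrict w (inputs N v)) = w (Msg i)))"

definition rate_vector :: "('v, 'e) network \<Rightarrow> (nat \<Rightarrow> nat) \<Rightarrow> nat \<Rightarrow> rat list" where
  "rate_vector N k n = map (\<lambda>i. of_nat (k i) / of_nat n) [0..<num_msgs N]"

lemma wf_arc_order:
  assumes "is_network N"
  shows "wf {(e', e). e' \<in> arcs (graph N) \<and> e \<in> arcs (graph N) \<and>
                      head (graph N) e' = tail (graph N) e}" (is "wf ?r")
proof (rule finite_acyclic_wf)
  from assms have fin: "finite (arcs (graph N))" and ac: "acyclic (arcs_ends (graph N))"
    by (auto simp: is_network_def fin_digraph.finite_arcs)
  show "finite ?r"
    by (rule finite_subset[of _ "arcs (graph N) \<times> arcs (graph N)"]) (use fin in auto)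
  have step: "(tail (graph N) e', tail (graph N) e) \<in> arcs_ends (graph N)"
    if "(e', e) \<in> ?r" for e' e
    using that by (auto simp: arcs_ends_conv image_iff)
  have "(tail (graph N) e', tail (graph N) e) \<in> (arcs_ends (graph N))\<^sup>+"
    if "(e', e) \<in> ?r\<^sup>+" for e' e
    using that by (induction rule: trancl_induct) (use step in \<open>blast intro: trancl_into_trancl\<close>)+
  then show "acyclic ?r"
    using ac unfolding acyclic_def by blast
qed

lemma ex_propagates:
  assumes "is_network N"
  shows "\<exists>w. (\<forall>i. w (Msg i) = x i) \<and> propagates N C w"
proof -
  let ?r = "{(e', e). e' \<in> arcs (graph N) \<and> e \<in> arcs (graph N) \<and>
                      head (graph N) e' = tail (graph N) e}"
  define F where "F g e = edge_fun C e
      (restrict (case_channel x g) (inputs N (tail (graph N) e)))" for g e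
  define w where "w = case_channel x (wfrec ?r F)"
  have "wfrec ?r F e = F (wfrec ?r F) e" if "e \<in> arcs (graph N)" for e
  proof -
    have "wfrec ?r F e = F (cut (wfrec ?r F) ?r e) e"
      by (rule wfrec[OF wf_arc_order[OF assms]])
    also have "\<dots> = F (wfrec ?r F) e"
      unfolding F_def
      by (rule arg_cong[where f = "edge_fun C e"])
         (auto simp: restrict_def inputs_def cut_def fun_eq_iff that split: channel.splits)
    finally show ?thesis .
  qed
  then have "propagates N C w"
    by (simp add: propagates_def w_def F_def)
  then show ?thesis
    by (intro exI[of _ w]) (simp add: w_def)
qed

lemma propagates_unique:
  assumes "is_network N" "propagates N C w" "propagates N C w'"
    and msgs: "\<And>i. i < num_msgs N \<Longrightarrow> w (Msg i) = w' (Msg i)"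
    and "e \<in> arcs (graph N)"
  shows "w (Arc e) = w' (Arc e)"
  using wf_arc_order[OF assms(1)] \<open>e \<in> arcs (graph N)\<close>
proof (induction e rule: wf_induct_rule)
  case (less e)
  have "restrict w (inputs N (tail (graph N) e)) = restrict w' (inputs N (tail (graph N) e))"
    by (rule restrict_ext) (use less msgs in \<open>auto simp: inputs_def\<close>)
  then show ?case
    using assms(2,3) less.prems by (simp add: propagates_def)
qed


section \<open>Two-sided linear codes and the linear capacity\<close>

text \<open>
  A function f of the inputs of node v, with values of length d, is two-sided linear if
  each of its components is a sum of terms a x b, where x is a component of an input vector;
  the number of terms for x, written s below, may vary with x and with the output component.
  A ring of class ring_1 has at least two elements.
\<close>

definition two_sided_linear_map ::
    "('v, 'e) network \<Rightarrow> (nat \<Rightarrow> nat) \<Rightarrow> nat \<Rightarrow> 'v \<Rightarrow> nat \<Rightarrow>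
     (('e channel \<Rightarrow> 'r::{ring_1, finite} list) \<Rightarrow> 'r list) \<Rightarrow> bool" where
  "two_sided_linear_map N k n v d f \<longleftrightarrow>
     (\<forall>j<d. \<exists>(s :: 'e channel \<Rightarrow> nat \<Rightarrow> nat) a b. \<forall>x\<in>input_space N k n v.
        f x ! j = (\<Sum>c\<in>inputs N v. \<Sum>l<block_size k n c. \<Sum>t<s c l.
                     a c l t * (x c ! l) * b c l t))"

definition two_sided_linear_code ::
    "('v, 'e) network \<Rightarrow> (nat \<Rightarrow> nat) \<Rightarrow> nat \<Rightarrow> ('v, 'e, 'r::{ring_1, finite}) code \<Rightarrow> bool" where
  "two_sided_linear_code N k n C \<longleftrightarrow>
     is_code N k n C \<and>
     (\<forall>e\<in>arcs (graph N). two_sided_linear_map N k n (tail (graph N) e) n (edge_fun C e)) \<and>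
     (\<forall>v\<in>receivers N. \<forall>i\<in>demand N v. two_sided_linear_map N k n v (k i) (decode_fun C v i))"

definition linearly_achievable ::
    "('v, 'e) network \<Rightarrow> 'r::{ring_1, finite} itself \<Rightarrow> rat list \<Rightarrow> bool" where
  "linearly_achievable N R rs \<longleftrightarrow>
     (\<exists>k n. \<exists>C :: ('v, 'e, 'r) code.
        n \<ge> 1 \<and> two_sided_linear_code N k n C \<and> is_solution N k n C \<and> rate_vector N k n = rs)"

definition lin_capacity :: "('v, 'e) network \<Rightarrow> 'r::{ring_1, finite} itself \<Rightarrow> ereal" where
  "lin_capacity N R =
     (SUP r\<in>{r :: rat. linearly_achievable N R (replicate (num_msgs N) r)}. ereal (of_rat r))"

end

theory Submission
  imports Defs "HOL-Number_Theory.Cong" "HOL-Algebra.Sylow"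
begin

text \<open>
  If a prime p divides both cardinalities, the ideal S of elements of R killed by p is a nonzero
  vector space over the prime field of F, and a code over R restricts to S, where it
  is given by matrices over the prime field.  These matrices are a solution over F of the same rate.

  If the cardinalities are coprime, put m = |F| + 1 and consider a generalized non-Fano network:
  bottlenecks carry the sum of m messages and the m sums that omit one of them, and a receiver
  recovers a message from the latter m sums.  It has to divide by m - 1 = |F|, which is
  possible over R.  Over F it is impossible, and a dimension count shows that this persists for
  rates close to 1: linear rates are at most 1 - 1 / (3 m).
\<close>

section \<open>Torsion in finite rings\<close>

text \<open>R need not be commutative and F may be a proper extension of its prime field; what the
  two share is only the integers modulo p. Hence all coordinates and matrix entries are integers,
  and equations hold modulo p.

  In the other direction, the capacity is a supremum, so failure at rate 1 would not suffice; a
  bound uniform in the block sizes is needed. At rate 1 the maps from a message into the bottlenecks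
  that it reaches would be bijections. One could then choose messages \<open>x i\<close> with a
  common nonzero contribution to bottleneck \<open>m\<close>, next \<open>s i\<close> cancelling
  what bottleneck \<open>i\<close> carries, next \<open>t i\<close> cancelling the contribution of
  \<open>s i\<close> to bottleneck \<open>m\<close>, and decoding would be contradicted. Below rate
  1 such choices may not exist, so \<open>x\<close>, \<open>s\<close>, \<open>t\<close> become
  unknowns to be counted: 3 m blocks of length k against (m - 1) + 2 m blocks of length n. This is
  the origin of 1 / (3 m).\<close>

text \<open>Translation by \<open>x\<close> permutes \<open>H\<close>, so the sum over
  \<open>H\<close> does not change although each of its terms grows by \<open>x\<close>. This is
  Lagrange's theorem for the additive group.\<close>

lemma of_nat_card_mult_closed:
  fixes H :: "'a::ring_1 set"
  assumes "finite H" "\<And>y z. y \<in> H \<Longrightarrow> z \<in> H \<Longrightarrow> y + z \<in> H" "x \<in> H"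
  shows "of_nat (card H) * x = 0"
proof -
  have inj: "inj_on (\<lambda>y. y + x) H"
    by (auto simp: inj_on_def)
  have "(\<lambda>y. y + x) ` H = H"
    by (rule endo_inj_surj) (use assms inj in auto)
  then have "(\<Sum>y\<in>H. y) = (\<Sum>y\<in>H. y + x)"
    using sum.reindex[OF inj, of "\<lambda>y. y"] by simp
  then show ?thesis
    by (simp add: sum.distrib)
qed

lemma of_nat_CARD_eq_0: "of_nat CARD('a) = (0 :: 'a::{ring_1, finite})"
  using of_nat_card_mult_closed[of UNIV "1::'a"] by simp

text \<open>Cauchy's theorem for the additive group: Sylow's theorem with exponent 1 gives a
  subgroup of order \<open>p\<close>, and the order of a subgroup kills its elements.\<close>

lemma exists_prime_torsion:
  assumes "prime p" "p dvd CARD('a::{ring_1, finite})"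
  shows "\<exists>x::'a. x \<noteq> 0 \<and> of_nat p * x = 0"
proof -
  define G :: "'a monoid" where "G = \<lparr>carrier = UNIV, monoid.mult = (+), one = 0\<rparr>"
  interpret G: group G
    by (rule groupI) (auto simp: G_def add.assoc intro: exI[of _ "- x" for x])
  obtain t where t: "CARD('a) = p * t"
    using assms(2) by blast
  then have "order G = p ^ 1 * t"
    by (simp add: order_def G_def)
  then obtain H where H: "subgroup H G" "card H = p ^ 1"
    using sylow_thm[OF assms(1) G.group_axioms, of 1 t] by (auto simp: G_def)
  have "1 < card H"
    using H(2) prime_gt_1_nat[OF assms(1)] by simp
  then have "\<not> H \<subseteq> {0}"
    using card_mono[of "{0::'a}" H] by auto
  then obtain x where x: "x \<in> H" "x \<noteq> 0"
    by blast
  have "of_nat (card H) * x = 0"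
    by (rule of_nat_card_mult_closed)
       (use x(1) subgroup.m_closed[OF H(1)] in \<open>auto simp: G_def\<close>)
  then show ?thesis
    using x H(2) by auto
qed

section \<open>Bases over the prime field, with integer coefficients\<close>

text \<open>A spanning subset of least cardinality is independent modulo \<open>p\<close>: a
  relation with a coefficient prime to \<open>p\<close> would allow an element to be
  dropped.\<close>

lemma torsion_set_basis:
  fixes S :: "'a::{ring_1, finite} set"
  assumes p: "prime p" and S: "\<And>x. x \<in> S \<Longrightarrow> of_nat p * x = 0"
  shows "\<exists>B\<subseteq>S. (\<forall>x\<in>S. \<exists>c::'a \<Rightarrow> int. x = (\<Sum>y\<in>B. of_int (c y) * y)) \<and>
    (\<forall>c::'a \<Rightarrow> int. (\<Sum>y\<in>B. of_int (c y) * y) = 0 \<longrightarrow> (\<forall>y\<in>B. int p dvd c y))"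
proof -
  define P where "P B \<longleftrightarrow> B \<subseteq> S \<and>
    (\<forall>x\<in>S. \<exists>c::'a \<Rightarrow> int. x = (\<Sum>y\<in>B. of_int (c y) * y))" for B
  have "\<exists>c::'a \<Rightarrow> int. x = (\<Sum>y\<in>S. of_int (c y) * y)" if "x \<in> S" for x
    using that by (intro exI[of _ "\<lambda>y. if y = x then 1 else 0"])
      (simp add: if_distrib if_distribR cong: if_cong)
  then have "P S"
    by (simp add: P_def)
  then obtain B where B: "P B" and least: "\<And>B'. P B' \<Longrightarrow> card B \<le> card B'"
    using arg_min_natI[of P S card] arg_min_nat_le[of P _ card] by metis
  have "int p dvd c z" if c: "(\<Sum>y\<in>B. of_int (c y) * y) = 0" and z: "z \<in> B" for c z
  proof (rule ccontr)
    assume "\<not> int p dvd c z"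
    then have "coprime (int p) (c z)"
      using p by (simp add: prime_imp_coprime)
    \<comment> \<open>\<open>u\<close> inverts \<open>c z\<close> modulo \<open>p\<close>; since
      \<open>p\<close> kills \<open>z\<close>, multiplying the relation by \<open>u\<close> isolates
      \<open>z\<close>.\<close>
    then obtain u where "[c z * u = 1] (mod int p)"
      using cong_solve_coprime_int[of "c z" "int p"] by (auto simp: coprime_commute)
    then obtain q where q: "c z * u = 1 + int p * q"
      by (metis add.commute cong_iff_lin cong_sym)
    have z0: "of_int (q * int p) * z = 0"
      using S[of z] B z by (auto simp: P_def mult.assoc)
    have "of_int (u * c z) * z = of_int (1 + q * int p) * z"
      using q by (simp add: mult.commute)
    also have "\<dots> = z"
      using z0 by (simp add: distrib_right)
    finally have zu: "of_int (u * c z) * z = z" .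
    have "of_int (c z) * z + (\<Sum>y\<in>B-{z}. of_int (c y) * y) = 0"
      using c z by (simp add: sum.remove[of B z])
    then have "of_int u * (of_int (c z) * z + (\<Sum>y\<in>B-{z}. of_int (c y) * y)) = 0"
      by simp
    then have zeq: "z = (\<Sum>y\<in>B-{z}. of_int (- u * c y) * y)"
      using zu by (simp add: distrib_left sum_distrib_left sum_negf mult.assoc eq_neg_iff_add_eq_0)
    have "\<exists>c'. x = (\<Sum>y\<in>B-{z}. of_int (c' y) * y)" if "x \<in> S" for x
    proof -
      obtain e where "x = (\<Sum>y\<in>B. of_int (e y) * y)"
        using B \<open>x \<in> S\<close> unfolding P_def by blast
      then have "x = of_int (e z) * z + (\<Sum>y\<in>B-{z}. of_int (e y) * y)"
        using z by (simp add: sum.remove[of B z])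
      also have "\<dots> = of_int (e z) * (\<Sum>y\<in>B-{z}. of_int (- u * c y) * y)
          + (\<Sum>y\<in>B-{z}. of_int (e y) * y)"
        using zeq by simp
      also have "\<dots> = (\<Sum>y\<in>B-{z}. of_int (e z * (- u * c y) + e y) * y)"
        by (simp add: sum_distrib_left sum.distrib distrib_right mult.assoc left_diff_distrib
            sum_subtractf sum_negf)
      finally show ?thesis
        by (rule exI[of _ "\<lambda>y. e z * (- u * c y) + e y"])
    qed
    then have "P (B - {z})"
      using B by (auto simp: P_def)
    from least[OF this] show False
      using z card_Diff1_less[of B z] by simp
  qed
  with B show ?thesis
    unfolding P_def by blast
qed

lemma torsion_basis:
  fixes S :: "'a::{ring_1, finite} set"
  assumes "prime p" and "\<And>x. x \<in> S \<Longrightarrow> of_nat p * x = 0"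
  obtains d :: nat and b :: "nat \<Rightarrow> 'a" and \<kappa> :: "'a \<Rightarrow> nat \<Rightarrow> int"
  where "\<And>i. i < d \<Longrightarrow> b i \<in> S"
    and "\<And>x. x \<in> S \<Longrightarrow> x = (\<Sum>i<d. of_int (\<kappa> x i) * b i)"
    and "\<And>c i. (\<Sum>i<d. of_int (c i) * b i) = 0 \<Longrightarrow> i < d \<Longrightarrow> int p dvd c i"
proof -
  obtain B where B: "B \<subseteq> S" "\<forall>x\<in>S. \<exists>c::'a \<Rightarrow> int. x = (\<Sum>y\<in>B. of_int (c y) * y)"
    "\<And>c::'a \<Rightarrow> int. (\<Sum>y\<in>B. of_int (c y) * y) = 0 \<Longrightarrow> (\<forall>y\<in>B. int p dvd c y)"
    using torsion_set_basis[of p S, OF assms] by blast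
  obtain \<kappa> :: "'a \<Rightarrow> 'a \<Rightarrow> int" where \<kappa>: "\<And>x. x \<in> S \<Longrightarrow> x = (\<Sum>y\<in>B. of_int (\<kappa> x y) * y)"
    using bchoice[OF B(2)] by blast
  obtain b where b: "bij_betw b {..<card B} B"
    using ex_bij_betw_nat_finite[of B] by (auto simp: atLeast0LessThan)
  show ?thesis
  proof (rule that[of "card B" b "\<lambda>x i. \<kappa> x (b i)"])
    show "b i \<in> S" if "i < card B" for i
      using that b B(1) by (auto simp: bij_betw_def)
    show "x = (\<Sum>i<card B. of_int (\<kappa> x (b i)) * b i)" if "x \<in> S" for x
      using \<kappa>[OF that] sum.reindex_bij_betw[OF b, of "\<lambda>y. of_int (\<kappa> x y) * y"] by simp
    show "int p dvd c i" if "(\<Sum>i<card B. of_int (c i) * b i) = 0" "i < card B" for c i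
    proof -
      let ?g = "inv_into {..<card B} b"
      have g: "?g (b j) = j" if "j < card B" for j
        using b that by (simp add: bij_betw_inv_into_left)
      have "(\<Sum>y\<in>B. of_int (c (?g y)) * y) = (\<Sum>i<card B. of_int (c (?g (b i))) * b i)"
        using sum.reindex_bij_betw[OF b, of "\<lambda>y. of_int (c (?g y)) * y"] by simp
      also have "\<dots> = 0"
        using that(1) by (simp add: g)
      finally have "\<forall>y\<in>B. int p dvd c (?g y)"
        by (rule B(3))
      then show ?thesis
        using that(2) b g[OF that(2)] bij_betwE by (metis lessThan_iff)
    qed
  qed
qed

text \<open>Elements killed by \<open>p\<close> form a module over the integers modulo
  \<open>p\<close>, so the choice of integer representatives does not matter.\<close>

lemma of_int_mult_cong:
  fixes x :: "'a::ring_1"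
  assumes "of_nat p * x = 0" "[a = c] (mod int p)"
  shows "of_int a * x = of_int c * x"
proof -
  obtain q where "a = c + q * int p"
    using assms(2) by (metis cong_iff_lin cong_sym mult.commute)
  then show ?thesis
    using assms(1) by (simp add: distrib_right mult.assoc)
qed

text \<open>The functionals are the coordinates with respect to a basis over the prime field, lifted
  to integers. Two expansions of one element differ by a relation, whose coefficients
  \<open>p\<close> divides; hence additivity holds modulo \<open>p\<close>. Elements with congruent
  coordinates have the same expansion.\<close>

lemma separating_functionals:
  assumes p: "prime p" and char: "of_nat p = (0::'f::{ring_1, finite})"
  obtains \<Phi> :: "('f::{ring_1, finite} \<Rightarrow> int) set"
  where "\<And>\<phi> x y. \<phi> \<in> \<Phi> \<Longrightarrow> [\<phi> (x + y) = \<phi> x + \<phi> y] (mod int p)"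
    and "\<And>\<phi> z x. \<phi> \<in> \<Phi> \<Longrightarrow> [\<phi> (of_int z * x) = z * \<phi> x] (mod int p)"
    and "\<And>x y. (\<And>\<phi>. \<phi> \<in> \<Phi> \<Longrightarrow> [\<phi> x = \<phi> y] (mod int p)) \<Longrightarrow> x = y"
proof (rule torsion_basis[OF p, of "UNIV :: 'f set"])
  show "of_nat p * x = 0" for x :: 'f
    by (simp add: char)
next
  fix d :: nat and b :: "nat \<Rightarrow> 'f" and \<kappa> :: "'f \<Rightarrow> nat \<Rightarrow> int"
  assume "\<And>x. x \<in> UNIV \<Longrightarrow> x = (\<Sum>i<d. of_int (\<kappa> x i) * b i)"
    and ind: "\<And>c i. (\<Sum>i<d. of_int (c i) * b i) = 0 \<Longrightarrow> i < d \<Longrightarrow> int p dvd c i"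
  then have b: "x = (\<Sum>i<d. of_int (\<kappa> x i) * b i)" for x
    by blast
  show ?thesis
  proof (rule that[of "(\<lambda>i x. \<kappa> x i) ` {..<d}"])
    fix \<phi> assume "\<phi> \<in> (\<lambda>i x. \<kappa> x i) ` {..<d}"
    then obtain i where i: "i < d" and \<phi>: "\<phi> = (\<lambda>x. \<kappa> x i)"
      by blast
    show "[\<phi> (x + y) = \<phi> x + \<phi> y] (mod int p)" for x y
    proof -
      have "(\<Sum>i<d. of_int (\<kappa> (x + y) i - (\<kappa> x i + \<kappa> y i)) * b i) = (x + y) - (x + y)"
        by (simp add: left_diff_distrib distrib_right sum_subtractf sum.distrib flip: b)
      then have "int p dvd \<kappa> (x + y) i - (\<kappa> x i + \<kappa> y i)"
        by (intro ind[OF _ i]) simp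
      then show ?thesis
        by (simp add: \<phi> cong_iff_dvd_diff)
    qed
    show "[\<phi> (of_int z * x) = z * \<phi> x] (mod int p)" for x z
    proof -
      have "(\<Sum>i<d. of_int (\<kappa> (of_int z * x) i - z * \<kappa> x i) * b i) = of_int z * x - of_int z * x"
        by (simp add: left_diff_distrib sum_subtractf mult.assoc flip: b sum_distrib_left)
      then have "int p dvd \<kappa> (of_int z * x) i - z * \<kappa> x i"
        by (intro ind[OF _ i]) simp
      then show ?thesis
        by (simp add: \<phi> cong_iff_dvd_diff)
    qed
  next
    fix x y assume *: "\<And>\<phi>. \<phi> \<in> (\<lambda>i x. \<kappa> x i) ` {..<d} \<Longrightarrow> [\<phi> x = \<phi> y] (mod int p)"
    have "(\<Sum>i<d. of_int (\<kappa> x i) * b i) = (\<Sum>i<d. of_int (\<kappa> y i) * b i)"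
      by (intro sum.cong refl of_int_mult_cong[of p]) (use * char in auto)
    then show "x = y"
      by (simp flip: b)
  qed
qed


section \<open>Transfer of linear codes from a ring to a field\<close>

lemma propagates_vecs:
  assumes N: "is_network N" and C: "is_code N k n C" and w: "propagates N C w"
    and msgs: "\<And>i. i < num_msgs N \<Longrightarrow> w (Msg i) \<in> vecs (k i)"
    and "e \<in> arcs (graph N)"
  shows "w (Arc e) \<in> vecs n"
  using wf_arc_order[OF N] \<open>e \<in> arcs (graph N)\<close>
proof (induction e rule: wf_induct_rule)
  case (less e)
  have "restrict w (inputs N (tail (graph N) e)) \<in> input_space N k n (tail (graph N) e)"
    unfolding input_space_def
    by (rule restrict_PiE_iff[THEN iffD2]) (use less msgs in \<open>auto simp: inputs_def\<close>)
  then show ?case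
    using C w less.prems by (simp add: propagates_def is_code_def)
qed

lemma propagates_input_space:
  assumes "is_network N" "is_code N k n C" "propagates N C w"
    "\<And>i. i < num_msgs N \<Longrightarrow> w (Msg i) \<in> vecs (k i)"
  shows "restrict w (inputs N v) \<in> input_space N k n v"
  unfolding input_space_def restrict_PiE_iff
  using assms(4) propagates_vecs[OF assms] by (auto simp: inputs_def)

lemma is_solutionD:
  assumes "is_solution N k n C" "\<And>i. i < num_msgs N \<Longrightarrow> w (Msg i) \<in> vecs (k i)"
    "propagates N C w" "v \<in> receivers N" "i \<in> demand N v"
  shows "decode_fun C v i (restrict w (inputs N v)) = w (Msg i)"
  using assms by (simp add: is_solution_def)

section \<open>Symbols of the ring as blocks of field symbols\<close>

lemma mult_add_less_mult:
  fixes l i K d :: nat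
  assumes "l < K" "i < d"
  shows "l * d + i < K * d"
proof -
  have "l * d + i < Suc l * d"
    using assms(2) by simp
  also have "\<dots> \<le> K * d"
    using assms(1) by (intro mult_le_mono1) simp
  finally show ?thesis .
qed

lemma sum_mult_divmod:
  fixes f :: "nat \<Rightarrow> nat \<Rightarrow> 'a::comm_monoid_add"
  shows "(\<Sum>L<K * d. f (L div d) (L mod d)) = (\<Sum>l<K. \<Sum>i<d. f l i)"
proof (cases "d = 0")
  case False
  have "(\<Sum>l<K. \<Sum>i<d. f l i) = (\<Sum>(l, i)\<in>{..<K} \<times> {..<d}. f l i)"
    by (simp add: sum.cartesian_product)
  also have "\<dots> = (\<Sum>L<K * d. f (L div d) (L mod d))"
    by (rule sum.reindex_bij_witness[of _ "\<lambda>L. (L div d, L mod d)" "\<lambda>(l, i). l * d + i"])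
       (use False in \<open>auto simp: less_mult_imp_div_less mult_add_less_mult\<close>)
  finally show ?thesis
    by simp
qed simp

text \<open>
  One symbol of the ring is represented by a block of d symbols of the field, its coordinates with
  respect to b; the functional \<open>\<phi>\<close> takes coordinates in the field to coordinates in the prime field.
\<close>

definition contract ::
    "nat \<Rightarrow> (nat \<Rightarrow> 'r) \<Rightarrow> ('f \<Rightarrow> int) \<Rightarrow> nat \<Rightarrow> 'f list \<Rightarrow> 'r::ring_1 list" where
  "contract d b \<phi> K ys = map (\<lambda>l. \<Sum>i<d. of_int (\<phi> (ys ! (l * d + i))) * b i) [0..<K]"

text \<open>\<open>b\<close> is a basis of the ideal \<open>S\<close> of R, and
  \<open>\<Phi>\<close> is a separating family of functionals on F. The two rings meet only in the
  integers modulo \<open>p\<close>, through which \<open>\<Phi>\<close> and \<open>\<kappa>\<close>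
  communicate.\<close>

locale torsion_transfer =
  fixes p d :: nat and S :: "'r::{ring_1, finite} set" and b :: "nat \<Rightarrow> 'r"
    and \<kappa> :: "'r \<Rightarrow> nat \<Rightarrow> int" and \<Phi> :: "('f::{field, finite} \<Rightarrow> int) set"
  assumes S_def: "S = {x. of_nat p * x = 0}"
    and b_mem: "i < d \<Longrightarrow> b i \<in> S"
    and basis: "x \<in> S \<Longrightarrow> x = (\<Sum>i<d. of_int (\<kappa> x i) * b i)"
    and indep: "(\<Sum>i<d. of_int (c i) * b i) = 0 \<Longrightarrow> i < d \<Longrightarrow> int p dvd c i"
    and \<Phi>_add: "\<phi> \<in> \<Phi> \<Longrightarrow> [\<phi> (s + t) = \<phi> s + \<phi> t] (mod int p)"
    and \<Phi>_mult: "\<phi> \<in> \<Phi> \<Longrightarrow> [\<phi> (of_int z * s) = z * \<phi> s] (mod int p)"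
    and \<Phi>_separating: "(\<And>\<phi>. \<phi> \<in> \<Phi> \<Longrightarrow> [\<phi> s = \<phi> t] (mod int p)) \<Longrightarrow> s = t"
begin

lemma b_cong: "i < d \<Longrightarrow> [z = z'] (mod int p) \<Longrightarrow> of_int z * b i = of_int z' * b i"
  using b_mem[of i] by (intro of_int_mult_cong[of p]) (auto simp: S_def)

lemma \<Phi>_0: "\<phi> \<in> \<Phi> \<Longrightarrow> [\<phi> 0 = 0] (mod int p)"
  using \<Phi>_mult[of \<phi> 0 0] by simp

lemma \<Phi>_sum: "\<phi> \<in> \<Phi> \<Longrightarrow> [\<phi> (\<Sum>x\<in>A. g x) = (\<Sum>x\<in>A. \<phi> (g x))] (mod int p)"
proof (induction A rule: infinite_finite_induct)
  case (insert x A)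
  have "[\<phi> (g x + sum g A) = \<phi> (g x) + \<phi> (sum g A)] (mod int p)"
    using insert by (intro \<Phi>_add)
  also have "[\<phi> (g x) + \<phi> (sum g A) = \<phi> (g x) + (\<Sum>x\<in>A. \<phi> (g x))] (mod int p)"
    using insert by (intro cong_add cong_refl) auto
  finally show ?case
    using insert by simp
qed (auto intro: \<Phi>_0)

lemma length_contract [simp]: "length (contract d b \<phi> K ys) = K"
  by (simp add: contract_def)

lemma contract_nth: "l < K \<Longrightarrow>
    contract d b \<phi> K ys ! l = (\<Sum>i<d. of_int (\<phi> (ys ! (l * d + i))) * b i)"
  by (simp add: contract_def)

text \<open>For each functional, independence of \<open>b\<close> recovers its values on all entries
  modulo \<open>p\<close>; taken together, these values determine the entries.\<close>

lemma contract_eqD: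
  assumes eq: "\<And>\<phi>. \<phi> \<in> \<Phi> \<Longrightarrow> contract d b \<phi> K ys = contract d b \<phi> K zs"
    and len: "length ys = K * d" "length zs = K * d"
  shows "ys = zs"
proof (rule nth_equalityI)
  fix L assume "L < length ys"
  then have L: "L < K * d"
    by (simp add: len)
  then have d: "d > 0"
    by (cases d) auto
  have l: "L div d < K" and i: "L mod d < d"
    using L d by (auto simp: less_mult_imp_div_less)
  show "ys ! L = zs ! L"
  proof (rule \<Phi>_separating)
    fix \<phi> assume \<phi>: "\<phi> \<in> \<Phi>"
    let ?c = "\<lambda>i. \<phi> (ys ! (L div d * d + i)) - \<phi> (zs ! (L div d * d + i))"
    have "(\<Sum>i<d. of_int (?c i) * b i) = 0"
      using arg_cong[OF eq[OF \<phi>], of "\<lambda>xs. xs ! (L div d)"] l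
      by (simp add: contract_nth left_diff_distrib sum_subtractf)
    from indep[OF this i] show "[\<phi> (ys ! L) = \<phi> (zs ! L)] (mod int p)"
      by (simp add: cong_iff_dvd_diff)
  qed
qed (simp add: len)

text \<open>Integers are central, so x \<mapsto> a x b maps \<open>S\<close> to itself and respects
  integer combinations: on \<open>S\<close> it is a matrix over the prime field. The same integer
  matrix acts on blocks over F, and every functional commutes with it modulo \<open>p\<close>. Thus
  a single \<open>f'\<close> serves all functionals at once.\<close>

lemma transfer_map:
  fixes N :: "('v, 'e) network"
  assumes f: "two_sided_linear_map N k n v D f"
    and len: "\<And>x. x \<in> input_space N k n v \<Longrightarrow> f x \<in> vecs D"
  shows "\<exists>f' :: ('e channel \<Rightarrow> 'f list) \<Rightarrow> 'f list.
    two_sided_linear_map N (\<lambda>i. k i * d) (n * d) v (D * d) f' \<and>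
    (\<forall>y. f' y \<in> vecs (D * d)) \<and>
    (\<forall>y. \<forall>\<phi>\<in>\<Phi>. f (\<lambda>c\<in>inputs N v. contract d b \<phi> (block_size k n c) (y c))
      = contract d b \<phi> D (f' y))"
proof -
  \<comment> \<open>\<open>\<Lambda> c l\<close> is the contribution of symbol \<open>l\<close> of
    channel \<open>c\<close> to output component \<open>j\<close>; these are the only properties of
    two-sided linearity used from here on.\<close>
  define P where "P j \<Lambda> \<longleftrightarrow>
      (\<forall>x\<in>input_space N k n v. f x ! j = (\<Sum>c\<in>inputs N v. \<Sum>l<block_size k n c. \<Lambda> c l (x c ! l))) \<and>
      (\<forall>c l (z :: nat \<Rightarrow> int). \<Lambda> c l (\<Sum>i<d. of_int (z i) * b i) = (\<Sum>i<d. of_int (z i) * \<Lambda> c l (b i))) \<and>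
      (\<forall>c l. \<forall>x\<in>S. \<Lambda> c l x \<in> S)" for j \<Lambda>
  have "\<exists>\<Lambda>. P j \<Lambda>" if j: "j < D" for j
  proof -
    obtain s :: "'e channel \<Rightarrow> nat \<Rightarrow> nat" and \<alpha> \<beta> where f_eq: "\<forall>x\<in>input_space N k n v.
        f x ! j = (\<Sum>c\<in>inputs N v. \<Sum>l<block_size k n c. \<Sum>t<s c l.
          \<alpha> c l t * (x c ! l) * \<beta> c l t)"
      using f j unfolding two_sided_linear_map_def by blast
    define \<Lambda> where "\<Lambda> c l x = (\<Sum>t<s c l. \<alpha> c l t * x * \<beta> c l t)" for c l x
    have "\<Lambda> c l (\<Sum>i<d. of_int (z i) * b i) = (\<Sum>i<d. of_int (z i) * \<Lambda> c l (b i))"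
      for c l and z :: "nat \<Rightarrow> int"
    proof -
      have "\<alpha> c l t * (of_int (z i) * b i) * \<beta> c l t
          = of_int (z i) * (\<alpha> c l t * b i * \<beta> c l t)" for t i
        using mult_of_int_commute[of "z i" "\<alpha> c l t"] by (metis mult.assoc)
      then have "\<Lambda> c l (\<Sum>i<d. of_int (z i) * b i)
          = (\<Sum>t<s c l. \<Sum>i<d. of_int (z i) * (\<alpha> c l t * b i * \<beta> c l t))"
        by (simp add: \<Lambda>_def sum_distrib_left sum_distrib_right)
      also have "\<dots> = (\<Sum>i<d. of_int (z i) * \<Lambda> c l (b i))"
        by (subst sum.swap) (simp add: \<Lambda>_def sum_distrib_left)
      finally show ?thesis .
    qed
    moreover have "\<Lambda> c l x \<in> S" if "x \<in> S" for c l x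
    proof -
      have "of_nat p * (\<alpha> c l t * x * \<beta> c l t) = \<alpha> c l t * (of_nat p * x) * \<beta> c l t" for t
        using mult_of_nat_commute[of p "\<alpha> c l t"] by (metis mult.assoc)
      then show ?thesis
        using that by (simp add: S_def \<Lambda>_def sum_distrib_left)
    qed
    ultimately show ?thesis
      unfolding P_def using f_eq by (intro exI[of _ \<Lambda>]) (simp add: \<Lambda>_def)
  qed
  then obtain \<Lambda>' where \<Lambda>': "\<And>j. j < D \<Longrightarrow> P j (\<Lambda>' j)"
    by metis
  have f_eq: "f x ! j = (\<Sum>c\<in>inputs N v. \<Sum>l<block_size k n c. \<Lambda>' j c l (x c ! l))"
    if "j < D" "x \<in> input_space N k n v" for j x
    using \<Lambda>'[OF that(1)] that(2) by (simp add: P_def)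
  have \<Lambda>'_sum: "\<Lambda>' j c l (\<Sum>i<d. of_int (z i :: int) * b i) = (\<Sum>i<d. of_int (z i) * \<Lambda>' j c l (b i))"
    if "j < D" for j c l z
    using \<Lambda>'[OF that] by (simp add: P_def)
  have \<Lambda>'_mem: "\<Lambda>' j c l x \<in> S" if "j < D" "x \<in> S" for j c l x
    using \<Lambda>'[OF that(1)] that(2) by (simp add: P_def)
  \<comment> \<open>Row \<open>J\<close> is coordinate \<open>J mod d\<close> of output symbol
    \<open>J div d\<close>; column \<open>L\<close> is basis vector \<open>L mod d\<close> in input
    symbol \<open>L div d\<close>.\<close>
  define M where "M J c L = \<kappa> (\<Lambda>' (J div d) c (L div d) (b (L mod d))) (J mod d)" for J c L
  define f' :: "('e channel \<Rightarrow> 'f list) \<Rightarrow> 'f list" where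
    "f' y = map (\<lambda>J. \<Sum>c\<in>inputs N v. \<Sum>L<block_size k n c * d. of_int (M J c L) * (y c ! L))
      [0..<D * d]" for y
  have bs: "block_size (\<lambda>i. k i * d) (n * d) c = block_size k n c * d" for c :: "'e channel"
    by (cases c) auto
  have lin: "two_sided_linear_map N (\<lambda>i. k i * d) (n * d) v (D * d) f'"
    unfolding two_sided_linear_map_def bs
  proof (intro allI impI)
    fix J assume "J < D * d"
    then show "\<exists>(s :: 'e channel \<Rightarrow> nat \<Rightarrow> nat) a b'. \<forall>x\<in>input_space N (\<lambda>i. k i * d) (n * d) v. f' x ! J =
      (\<Sum>c\<in>inputs N v. \<Sum>l<block_size k n c * d. \<Sum>t<s c l. a c l t * x c ! l * b' c l t)"
      by (intro exI[of _ "\<lambda>_ _. 1"] exI[of _ "\<lambda>c l t. of_int (M J c l)"] exI[of _ "\<lambda>_ _ _. 1"])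
         (simp add: f'_def)
  qed
  have key: "f (\<lambda>c\<in>inputs N v. contract d b \<phi> (block_size k n c) (y c)) = contract d b \<phi> D (f' y)"
    (is "f ?x = _") if \<phi>: "\<phi> \<in> \<Phi>" for y \<phi>
  proof (rule nth_equalityI)
    have x: "?x \<in> input_space N k n v"
      by (simp add: input_space_def restrict_PiE_iff vecs_def)
    show lens: "length (f ?x) = length (contract d b \<phi> D (f' y))"
      using len[OF x] by (simp add: vecs_def)
    fix j assume "j < length (f ?x)"
    then have j: "j < D"
      using lens by simp
    have J: "j * d + i < D * d" if "i < d" for i
      using j that by (rule mult_add_less_mult)
    have "contract d b \<phi> D (f' y) ! j
        = (\<Sum>i<d. of_int (\<phi> (\<Sum>c\<in>inputs N v. \<Sum>L<block_size k n c * d.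
            of_int (M (j * d + i) c L) * (y c ! L))) * b i)"
      using J by (simp add: contract_nth[OF j] f'_def)
    also have "\<dots> = (\<Sum>i<d. of_int (\<Sum>c\<in>inputs N v. \<Sum>L<block_size k n c * d.
            M (j * d + i) c L * \<phi> (y c ! L)) * b i)"
    \<comment> \<open>The functional passes through the matrix only modulo \<open>p\<close>, which
      suffices because the integers multiply basis elements killed by \<open>p\<close>.\<close>
    proof (intro sum.cong refl b_cong)
      fix i
      have "[\<phi> (\<Sum>c\<in>inputs N v. \<Sum>L<block_size k n c * d. of_int (M (j * d + i) c L) * (y c ! L))
        = (\<Sum>c\<in>inputs N v. \<phi> (\<Sum>L<block_size k n c * d. of_int (M (j * d + i) c L) * (y c ! L)))]
        (mod int p)"
        by (rule \<Phi>_sum[OF \<phi>])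
      also have "[(\<Sum>c\<in>inputs N v.
            \<phi> (\<Sum>L<block_size k n c * d. of_int (M (j * d + i) c L) * (y c ! L)))
        = (\<Sum>c\<in>inputs N v. \<Sum>L<block_size k n c * d. \<phi> (of_int (M (j * d + i) c L) * (y c ! L)))]
        (mod int p)"
        by (intro cong_sum \<Phi>_sum[OF \<phi>])
      also have "[(\<Sum>c\<in>inputs N v.
            \<Sum>L<block_size k n c * d. \<phi> (of_int (M (j * d + i) c L) * (y c ! L)))
        = (\<Sum>c\<in>inputs N v. \<Sum>L<block_size k n c * d. M (j * d + i) c L * \<phi> (y c ! L))]
        (mod int p)"
        by (intro cong_sum \<Phi>_mult[OF \<phi>])
      finally show "[\<phi> (\<Sum>c\<in>inputs N v. \<Sum>L<block_size k n c * d.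
            of_int (M (j * d + i) c L) * (y c ! L))
        = (\<Sum>c\<in>inputs N v. \<Sum>L<block_size k n c * d. M (j * d + i) c L * \<phi> (y c ! L))]
        (mod int p)" .
    qed simp
    also have "\<dots> = (\<Sum>i<d. \<Sum>c\<in>inputs N v. \<Sum>L<block_size k n c * d.
            of_int (\<phi> (y c ! L)) * (of_int (M (j * d + i) c L) * b i))"
      by (simp add: sum_distrib_right mult.commute[of _ "\<phi> _"] mult.assoc)
    also have "\<dots> = (\<Sum>c\<in>inputs N v. \<Sum>L<block_size k n c * d.
            of_int (\<phi> (y c ! L)) * (\<Sum>i<d. of_int (M (j * d + i) c L) * b i))"
      by (subst sum.swap, rule sum.cong[OF refl], subst sum.swap) (simp add: sum_distrib_left)
    \<comment> \<open>A column of \<open>M\<close> lists the coordinates of the image of a basis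
      vector, so the sum over \<open>i\<close> reassembles this image.\<close>
    also have "\<dots> = (\<Sum>c\<in>inputs N v. \<Sum>L<block_size k n c * d.
            of_int (\<phi> (y c ! (L div d * d + L mod d))) * \<Lambda>' j c (L div d) (b (L mod d)))"
    proof (intro sum.cong refl)
      fix c :: "'e channel" and L assume "L \<in> {..<block_size k n c * d}"
      then have "L mod d < d"
        by (cases d) auto
      then have "\<Lambda>' j c (L div d) (b (L mod d)) = (\<Sum>i<d. of_int (M (j * d + i) c L) * b i)"
        using basis[OF \<Lambda>'_mem[OF j b_mem[OF \<open>L mod d < d\<close>]], of c "L div d"] by (simp add: M_def)
      then show "of_int (\<phi> (y c ! L)) * (\<Sum>i<d. of_int (M (j * d + i) c L) * b i) =
          of_int (\<phi> (y c ! (L div d * d + L mod d))) * \<Lambda>' j c (L div d) (b (L mod d))"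
        by simp
    qed
    also have "\<dots> = (\<Sum>c\<in>inputs N v. \<Sum>l<block_size k n c. \<Sum>i<d.
            of_int (\<phi> (y c ! (l * d + i))) * \<Lambda>' j c l (b i))"
      by (rule sum.cong[OF refl])
         (rule sum_mult_divmod[of "\<lambda>l i. of_int (\<phi> (y c ! (l * d + i))) * \<Lambda>' j c l (b i)" for c])
    also have "\<dots> = (\<Sum>c\<in>inputs N v. \<Sum>l<block_size k n c.
            \<Lambda>' j c l (contract d b \<phi> (block_size k n c) (y c) ! l))"
      by (simp add: contract_nth \<Lambda>'_sum[OF j])
    also have "\<dots> = f ?x ! j"
      by (simp add: f_eq[OF j x])
    finally show "f ?x ! j = contract d b \<phi> D (f' y) ! j"
      by simp
  qed
  show ?thesis
    by (rule exI[of _ f']) (use lin key in \<open>auto simp: vecs_def f'_def\<close>)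
qed

text \<open>Contracting a run of the new code by any functional gives a run of the old code, which
  decodes correctly. So the decoded blocks and the messages over F have equal contractions for every
  functional, hence are equal.\<close>

lemma transfer_solution:
  fixes N :: "('v, 'e) network" and C :: "('v, 'e, 'r) code"
  assumes N: "is_network N" and C: "two_sided_linear_code N k n C" "is_solution N k n C"
  shows "\<exists>C' :: ('v, 'e, 'f) code. two_sided_linear_code N (\<lambda>i. k i * d) (n * d) C' \<and>
    is_solution N (\<lambda>i. k i * d) (n * d) C'"
proof -
  let ?k = "\<lambda>i. k i * d" and ?n = "n * d"
  let ?T = "\<lambda>\<phi> w c. contract d b \<phi> (block_size k n c) (w c)"
  have code: "is_code N k n C"
    using C(1) by (simp add: two_sided_linear_code_def)
  define P where "P e f' \<longleftrightarrow>
      two_sided_linear_map N ?k ?n (tail (graph N) e) ?n f' \<and> (\<forall>y. f' y \<in> vecs ?n) \<and>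
      (\<forall>y. \<forall>\<phi>\<in>\<Phi>. edge_fun C e (restrict (?T \<phi> y) (inputs N (tail (graph N) e)))
        = contract d b \<phi> n (f' y))" for e f'
  have "\<exists>f'. P e f'" if "e \<in> arcs (graph N)" for e
    unfolding P_def
    by (rule transfer_map) (use C(1) that in \<open>auto simp: two_sided_linear_code_def is_code_def\<close>)
  then obtain ef where ef: "\<And>e. e \<in> arcs (graph N) \<Longrightarrow> P e (ef e)"
    by metis
  define Q where "Q v i f' \<longleftrightarrow>
      two_sided_linear_map N ?k ?n v (?k i) f' \<and> (\<forall>y. f' y \<in> vecs (?k i)) \<and>
      (\<forall>y. \<forall>\<phi>\<in>\<Phi>. decode_fun C v i (restrict (?T \<phi> y) (inputs N v))
        = contract d b \<phi> (k i) (f' y))" for v i f'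
  have "\<exists>f'. Q v i f'" if "v \<in> receivers N" "i \<in> demand N v" for v i
    unfolding Q_def
    by (rule transfer_map) (use C(1) that in \<open>auto simp: two_sided_linear_code_def is_code_def\<close>)
  then obtain df where df: "\<And>v i. v \<in> receivers N \<Longrightarrow> i \<in> demand N v \<Longrightarrow> Q v i (df v i)"
    by metis
  define C' :: "('v, 'e, 'f) code" where "C' = \<lparr>edge_fun = ef, decode_fun = df\<rparr>"
  have code': "is_code N ?k ?n C'"
    using ef df by (simp add: is_code_def C'_def P_def Q_def)
  have restr: "restrict (?T \<phi> (restrict w A)) A = restrict (?T \<phi> w) A" for \<phi> w A
    by auto
  have "decode_fun C' v i (restrict w (inputs N v)) = w (Msg i)"
    if msgs: "\<And>i. i < num_msgs N \<Longrightarrow> w (Msg i) \<in> vecs (?k i)" and w: "propagates N C' w"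
      and v: "v \<in> receivers N" and i: "i \<in> demand N v" for w v i
  proof (rule contract_eqD[of "k i"])
    have "i < num_msgs N"
      using N v i by (auto simp: is_network_def)
    then show "length (w (Msg i)) = k i * d"
      using msgs by (simp add: vecs_def)
    show "length (decode_fun C' v i (restrict w (inputs N v))) = k i * d"
      using df[OF v i] by (simp add: C'_def vecs_def Q_def)
    fix \<phi> assume \<phi>: "\<phi> \<in> \<Phi>"
    have "propagates N C (?T \<phi> w)"
      unfolding propagates_def
    proof
      fix e assume e: "e \<in> arcs (graph N)"
      let ?I = "inputs N (tail (graph N) e)"
      have "edge_fun C e (restrict (?T \<phi> w) ?I) = edge_fun C e (restrict (?T \<phi> (restrict w ?I)) ?I)"
        by (simp only: restr)
      also have "\<dots> = contract d b \<phi> n (ef e (restrict w ?I))"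
        using ef[OF e] \<phi> unfolding P_def by blast
      also have "\<dots> = contract d b \<phi> n (w (Arc e))"
        using w e by (simp add: propagates_def C'_def)
      finally show "?T \<phi> w (Arc e) = edge_fun C e (restrict (?T \<phi> w) ?I)"
        by simp
    qed
    moreover have "\<forall>i<num_msgs N. ?T \<phi> w (Msg i) \<in> vecs (k i)"
      by (simp add: vecs_def)
    ultimately have "decode_fun C v i (restrict (?T \<phi> w) (inputs N v)) = ?T \<phi> w (Msg i)"
      by (intro is_solutionD[OF C(2) _ _ v i]) auto
    moreover have "decode_fun C v i (restrict (?T \<phi> (restrict w (inputs N v))) (inputs N v))
        = contract d b \<phi> (k i) (df v i (restrict w (inputs N v)))"
      by (rule df[OF v i, unfolded Q_def, THEN conjunct2, THEN conjunct2, THEN spec, THEN bspec, OF \<phi>])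
    ultimately show "contract d b \<phi> (k i) (decode_fun C' v i (restrict w (inputs N v)))
        = contract d b \<phi> (k i) (w (Msg i))"
      by (simp only: restr C'_def code.simps block_size.simps)
  qed
  then have "is_solution N ?k ?n C'"
    using code' by (simp add: is_solution_def)
  moreover have "two_sided_linear_code N ?k ?n C'"
    using code' ef df by (simp add: two_sided_linear_code_def C'_def P_def Q_def)
  ultimately show ?thesis
    by blast
qed

end

text \<open>Message lengths and edge length are both multiplied by \<open>d\<close>, the dimension
  of \<open>S\<close>, so rates are preserved.\<close>

lemma lin_capacity_mono_common_prime:
  fixes N :: "('v, 'e) network"
  assumes N: "is_network N" and p: "prime p"
    and dvd: "p dvd CARD('f::{field, finite})" "p dvd CARD('r::{ring_1, finite})"
  shows "lin_capacity N TYPE('r) \<le> lin_capacity N TYPE('f)"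
proof -
  obtain x :: 'f where "x \<noteq> 0" "of_nat p * x = 0"
    using exists_prime_torsion[OF p dvd(1)] by blast
  then have char: "of_nat p = (0::'f)"
    by simp
  obtain y :: 'r where y: "y \<noteq> 0" "of_nat p * y = 0"
    using exists_prime_torsion[OF p dvd(2)] by blast
  define S where "S = {x::'r. of_nat p * x = 0}"
  obtain d :: nat and b \<kappa> where b: "\<And>i. i < d \<Longrightarrow> b i \<in> S"
    "\<And>x. x \<in> S \<Longrightarrow> x = (\<Sum>i<d. of_int (\<kappa> x i) * b i)"
    "\<And>c i. (\<Sum>i<d. of_int (c i) * b i) = 0 \<Longrightarrow> i < d \<Longrightarrow> int p dvd c i"
    using torsion_basis[OF p, of S] unfolding S_def by blast
  obtain \<Phi> :: "('f \<Rightarrow> int) set"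
    where \<Phi>: "\<And>\<phi> x y. \<phi> \<in> \<Phi> \<Longrightarrow> [\<phi> (x + y) = \<phi> x + \<phi> y] (mod int p)"
      "\<And>\<phi> z x. \<phi> \<in> \<Phi> \<Longrightarrow> [\<phi> (of_int z * x) = z * \<phi> x] (mod int p)"
      "\<And>x y. (\<And>\<phi>. \<phi> \<in> \<Phi> \<Longrightarrow> [\<phi> x = \<phi> y] (mod int p)) \<Longrightarrow> x = y"
    using separating_functionals[OF p char] by blast
  interpret torsion_transfer p d S b \<kappa> \<Phi>
    by unfold_locales (fact S_def b \<Phi>)+
  \<comment> \<open>The new edge length \<open>n * d\<close> has to be positive; nonzero torsion in
    R ensures this.\<close>
  have "d > 0"
  proof (rule ccontr)
    assume "\<not> d > 0"
    then show False
      using b(2)[of y] y by (simp add: S_def)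
  qed
  have "linearly_achievable N TYPE('f) rs" if R: "linearly_achievable N TYPE('r) rs" for rs
  proof -
    from R obtain k n and C :: "('v, 'e, 'r) code" where *: "n \<ge> 1"
      "two_sided_linear_code N k n C" "is_solution N k n C" "rate_vector N k n = rs"
      unfolding linearly_achievable_def by blast
    have "rate_vector N (\<lambda>i. k i * d) (n * d) = rs"
      using *(4) \<open>d > 0\<close> by (simp add: rate_vector_def)
    with transfer_solution[OF N *(2,3)] *(1) \<open>d > 0\<close> show ?thesis
      unfolding linearly_achievable_def by (metis One_nat_def Suc_leI mult_pos_pos less_le_trans zero_less_one)
  qed
  then show ?thesis
    unfolding lin_capacity_def by (intro SUP_subset_mono) auto
qed


section \<open>The generalized non-Fano network\<close>

text \<open>Differences are used because compatibility with them yields the value 0 at 0, negation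
  and addition.\<close>

lemma two_sided_linear_map_diff:
  fixes N :: "('v, 'e) network" and f :: "('e channel \<Rightarrow> 'r::{ring_1, finite} list) \<Rightarrow> 'r list"
  assumes f: "two_sided_linear_map N k n v D f"
    and len: "\<And>x. x \<in> input_space N k n v \<Longrightarrow> f x \<in> vecs D"
    and x: "x \<in> input_space N k n v" and y: "y \<in> input_space N k n v"
  shows "f (\<lambda>c\<in>inputs N v. map2 (-) (x c) (y c)) = map2 (-) (f x) (f y)"
proof (rule nth_equalityI)
  let ?z = "\<lambda>c\<in>inputs N v. map2 (-) (x c) (y c)"
  have l: "length (x c) = block_size k n c" "length (y c) = block_size k n c"
    if "c \<in> inputs N v" for c
    using x y that by (auto simp: input_space_def vecs_def)
  then have z: "?z \<in> input_space N k n v"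
    by (auto simp: input_space_def vecs_def)
  show "length (f ?z) = length (map2 (-) (f x) (f y))"
    using len[OF x] len[OF y] len[OF z] by (simp add: vecs_def)
  fix j assume "j < length (f ?z)"
  then have j: "j < D"
    using len[OF z] by (simp add: vecs_def)
  obtain s :: "'e channel \<Rightarrow> nat \<Rightarrow> nat" and a b where eq: "\<forall>x\<in>input_space N k n v.
      f x ! j = (\<Sum>c\<in>inputs N v. \<Sum>l<block_size k n c. \<Sum>t<s c l. a c l t * (x c ! l) * b c l t)"
    using f j unfolding two_sided_linear_map_def by blast
  have "f ?z ! j = (\<Sum>c\<in>inputs N v. \<Sum>l<block_size k n c. \<Sum>t<s c l.
      a c l t * (x c ! l - y c ! l) * b c l t)"
    using eq z by (auto intro!: sum.cong simp: l)
  also have "\<dots> = f x ! j - f y ! j"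
    using eq x y by (simp add: right_diff_distrib left_diff_distrib sum_subtractf)
  finally show "f ?z ! j = map2 (-) (f x) (f y) ! j"
    using len[OF x] len[OF y] j by (simp add: vecs_def)
qed

lemma propagates_diff:
  fixes N :: "('v, 'e) network" and C :: "('v, 'e, 'r::{ring_1, finite}) code"
  assumes N: "is_network N" and C: "two_sided_linear_code N k n C"
    and w: "propagates N C w" "\<And>i. i < num_msgs N \<Longrightarrow> w (Msg i) \<in> vecs (k i)"
    and w': "propagates N C w'" "\<And>i. i < num_msgs N \<Longrightarrow> w' (Msg i) \<in> vecs (k i)"
  shows "propagates N C (\<lambda>c. map2 (-) (w c) (w' c))"
  unfolding propagates_def
proof
  fix e assume e: "e \<in> arcs (graph N)"
  let ?v = "tail (graph N) e"
  have code: "is_code N k n C"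
    using C by (simp add: two_sided_linear_code_def)
  have "restrict (\<lambda>c. map2 (-) (w c) (w' c)) (inputs N ?v) =
      (\<lambda>c\<in>inputs N ?v. map2 (-) (restrict w (inputs N ?v) c) (restrict w' (inputs N ?v) c))"
    by auto
  moreover have "edge_fun C e \<dots> = map2 (-) (edge_fun C e (restrict w (inputs N ?v)))
      (edge_fun C e (restrict w' (inputs N ?v)))"
  proof (rule two_sided_linear_map_diff)
    show "two_sided_linear_map N k n ?v n (edge_fun C e)"
      using C e by (simp add: two_sided_linear_code_def)
    show "edge_fun C e x \<in> vecs n" if "x \<in> input_space N k n ?v" for x
      using code e that by (simp add: is_code_def)
  qed (use propagates_input_space[OF N code] w w' in blast)+
  ultimately show "map2 (-) (w (Arc e)) (w' (Arc e)) =
      edge_fun C e (restrict (\<lambda>c. map2 (-) (w c) (w' c)) (inputs N ?v))"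
    using w(1) w'(1) e by (simp add: propagates_def)
qed

text \<open>
  G i x is what bottleneck i carries for the messages x, with bottleneck m receiving all of them.
  The proof counts the image of an injective map \<open>\<Psi>\<close> on (x, s, t): its values are the differences of
  the contributions of x i and x 0 to bottleneck m and, for all i < m and some j = oth i \<open>\<noteq>\<close> i,
  the sum of G i x and of the contribution of s i in position j to bottleneck i, and
  the sum of the contributions of s i in position j and t i in position i to bottleneck m.
  If all this vanishes, then all x i contribute the same vector v to bottleneck m, so it carries
  m v = v, and removing x i from x makes it carry 0.  Adding s i and t i to the rest gives messages y
  with G i y = G m y = 0, hence t i = y i = 0, and then s i = 0 and G i x = 0.
\<close>

lemma bottleneck_bound:
  fixes G :: "nat \<Rightarrow> (nat \<Rightarrow> nat \<Rightarrow> 'f::{ring_1, finite}) \<Rightarrow> nat \<Rightarrow> 'f"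
  assumes m: "of_nat m = (1::'f)" "m \<ge> 2"
    and diff: "\<And>i x y. i \<le> m \<Longrightarrow> G i (\<lambda>j l. x j l - y j l) = (\<lambda>l. G i x l - G i y l)"
    and supp: "\<And>i x l. i \<le> m \<Longrightarrow> l \<ge> n \<Longrightarrow> G i x l = 0"
    and local: "\<And>i x y. i \<le> m \<Longrightarrow> (\<And>j l. j < m \<Longrightarrow> j \<noteq> i \<Longrightarrow> l < k \<Longrightarrow> x j l = y j l) \<Longrightarrow> G i x = G i y"
    and dec: "\<And>i x l. i < m \<Longrightarrow> G i x = (\<lambda>_. 0) \<Longrightarrow> G m x = (\<lambda>_. 0) \<Longrightarrow> l < k \<Longrightarrow> x i l = 0"
    and dec0: "\<And>x l. (\<And>i. i < m \<Longrightarrow> G i x = (\<lambda>_. 0)) \<Longrightarrow> l < k \<Longrightarrow> x 0 l = 0"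
  shows "3 * m * k \<le> (3 * m - 1) * n"
proof -
  define slot :: "nat \<Rightarrow> (nat \<Rightarrow> 'f) \<Rightarrow> nat \<Rightarrow> nat \<Rightarrow> 'f"
    where "slot i s = (\<lambda>j l. if j = i then s l else 0)" for i s
  define oth :: "nat \<Rightarrow> nat" where "oth i = (if i = 0 then 1 else 0)" for i
  have oth: "oth i < m" "oth i \<noteq> i" for i
    using m(2) by (auto simp: oth_def)
  have zero: "G i (\<lambda>_ _. 0) = (\<lambda>_. 0)" if "i \<le> m" for i
    using diff[OF that, of "\<lambda>_ _. 0" "\<lambda>_ _. 0"] by simp
  have add: "G i (\<lambda>j l. x j l + y j l) = (\<lambda>l. G i x l + G i y l)" if "i \<le> m" for i x y
    using diff[OF that, of x "\<lambda>j l. 0 - y j l"] diff[OF that, of "\<lambda>_ _. 0" y] zero[OF that] by simp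
  have sum: "G i (\<lambda>j l. \<Sum>a\<in>A. x a j l) = (\<lambda>l. \<Sum>a\<in>A. G i (x a) l)" if "i \<le> m" for i A and x :: "nat \<Rightarrow> _"
    by (induction A rule: infinite_finite_induct) (simp_all add: zero that add)
  have slot_self: "G i (slot i s) = (\<lambda>_. 0)" if "i < m" for i s
    using local[of i "slot i s" "\<lambda>_ _. 0"] zero[of i] that by (auto simp: slot_def)
  define I where "I = ({..<3} \<times> {..<m} \<times> {..<k} :: (nat \<times> nat \<times> nat) set)"
  \<comment> \<open>Family 0 starts at index 1, since the difference of \<open>x 0\<close> with
    itself is void. This saves one block of length \<open>n\<close>.\<close>
  define J where "J = ({0} \<times> {1..<m} \<times> {..<n} \<union> {1,2} \<times> {..<m} \<times> {..<n} :: (nat \<times> nat \<times> nat) set)"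
  define ext where "ext a z = (\<lambda>i l. if i < m \<and> l < k then z (a, i, l) else 0)"
    for a :: nat and z :: "nat \<times> nat \<times> nat \<Rightarrow> 'f"
  define \<Psi> where "\<Psi> z = (\<lambda>(a :: nat, i, l).
      if a = 0 then G m (slot i (ext 0 z i)) l - G m (slot 0 (ext 0 z 0)) l
      else if a = 1 then G i (ext 0 z) l + G i (slot (oth i) (ext 1 z i)) l
      else G m (slot (oth i) (ext 1 z i)) l + G m (slot i (ext 2 z i)) l)"
    for z :: "nat \<times> nat \<times> nat \<Rightarrow> 'f"
  have \<Psi>_diff: "\<Psi> (\<lambda>q. z q - z' q) (a, i, l) = \<Psi> z (a, i, l) - \<Psi> z' (a, i, l)" if "i \<le> m" for z z' a i l
  proof -
    have "ext a (\<lambda>q. z q - z' q) = (\<lambda>i l. ext a z i l - ext a z' i l)" for a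
      by (auto simp: ext_def fun_eq_iff)
    moreover have "slot i (\<lambda>l. s l - t l) = (\<lambda>j l. slot i s j l - slot i t j l)" for i s t
      by (auto simp: slot_def fun_eq_iff)
    ultimately show ?thesis
      using that by (simp add: \<Psi>_def diff)
  qed
  have kernel: "ext a z i l = 0"
    if \<Psi>0: "\<And>q. q \<in> J \<Longrightarrow> \<Psi> z q = 0" and a: "a < 3" and i: "i < m" and l: "l < k" for z a i l
  proof -
    define x s t where "x = ext 0 z" and "s = ext 1 z" and "t = ext 2 z"
    note xst = x_def s_def t_def
    define v where "v = G m (slot 0 (x 0))"
    have all_v: "G m (slot i (x i)) = v" if "i < m" for i
    proof (cases "i = 0")
      case False
      show ?thesis
      proof
        fix l show "G m (slot i (x i)) l = v l"
          using \<Psi>0[of "(0, i, l)"] supp[of m l] that False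
          by (cases "l < n") (auto simp: J_def \<Psi>_def xst v_def)
      qed
    qed (simp add: v_def)
    have "G m x = G m (\<lambda>j l. \<Sum>i<m. slot i (x i) j l)"
      by (rule local) (auto simp: slot_def if_distrib if_distribR cong: if_cong)
    also have "\<dots> = (\<lambda>l. \<Sum>i<m. v l)"
      by (simp add: sum all_v)
    \<comment> \<open>Here the characteristic enters: \<open>m\<close> copies of \<open>v\<close>
      add up to \<open>v\<close>.\<close>
    finally have Gm: "G m x = v"
      using m(1) by simp
    have st: "s i l = 0 \<and> t i l = 0" and Gx: "G i x = (\<lambda>_. 0)" if i: "i < m" for i l
    proof -
      have e1: "G i x l + G i (slot (oth i) (s i)) l = 0" for l
        using \<Psi>0[of "(1, i, l)"] supp[of i l] i
        by (cases "l < n") (auto simp: J_def \<Psi>_def xst)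
      have e2: "G m (slot (oth i) (s i)) l + G m (slot i (t i)) l = 0" for l
        using \<Psi>0[of "(2, i, l)"] supp[of m l] i
        by (cases "l < n") (auto simp: J_def \<Psi>_def xst)
      define y where "y = (\<lambda>j l. ((x j l - slot i (x i) j l) + slot (oth i) (s i) j l) + slot i (t i) j l)"
      have "G i y = (\<lambda>_. 0)"
        using e1 i by (simp add: y_def add diff slot_self)
      moreover have "G m y = (\<lambda>_. 0)"
        using e2 i by (simp add: y_def add diff all_v Gm add.assoc)
      ultimately have "y i l = 0" if "l < k" for l
        using dec[OF i] that by blast
      then have "t i l = 0" if "l < k" for l
        using that oth[of i] by (auto simp: y_def slot_def)
      then have t0: "t i = (\<lambda>_. 0)"
        by (auto simp: t_def ext_def fun_eq_iff)
      have slot0: "slot j (\<lambda>_. 0) = (\<lambda>_ _. 0)" for j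
        by (auto simp: slot_def fun_eq_iff)
      \<comment> \<open>With \<open>t i = 0\<close>, the message \<open>s i\<close> alone in
        position \<open>oth i\<close> is invisible to bottlenecks \<open>oth i\<close> and
        \<open>m\<close>, from which it can be decoded.\<close>
      have "G m (slot (oth i) (s i)) = (\<lambda>_. 0)"
        using e2 by (intro ext) (simp add: t0 slot0 zero)
      from dec[OF oth(1) slot_self[OF oth(1)] this] have "s i l = 0" if "l < k" for l
        using that by (auto simp: slot_def)
      then have s0: "s i = (\<lambda>_. 0)"
        by (auto simp: s_def ext_def fun_eq_iff)
      show "s i l = 0 \<and> t i l = 0"
        using t0 s0 by simp
      show "G i x = (\<lambda>_. 0)"
        using e1 i by (intro ext) (simp add: s0 slot0 zero)
    qed
    \<comment> \<open>The last decoding rule now gives \<open>x 0 = 0\<close>, so the common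
      contribution \<open>v\<close> vanishes, and each \<open>x i\<close> can be decoded as 0 from
      its own slot.\<close>
    have "x 0 l = 0" if "l < k" for l
      using dec0[OF Gx that] .
    then have "x 0 = (\<lambda>_. 0)"
      by (auto simp: x_def ext_def fun_eq_iff)
    then have "v = (\<lambda>_. 0)"
      using zero[of m] by (simp add: v_def slot_def cong: if_cong)
    then have "G m (slot i (x i)) = (\<lambda>_. 0)"
      using all_v i by simp
    from dec[OF i slot_self[OF i] this l] have "x i l = 0"
      by (simp add: slot_def)
    moreover have "a = 0 \<or> a = 1 \<or> a = 2"
      using a by linarith
    ultimately show ?thesis
      using st[OF i] by (auto simp: xst)
  qed
  \<comment> \<open>The maps are merely known to be additive, so elements are counted instead of
    comparing ranks; trivial kernel gives injectivity through differences.\<close>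
  have "inj_on (\<lambda>z. restrict (\<Psi> z) J) (I \<rightarrow>\<^sub>E (UNIV :: 'f set))"
  proof (rule inj_onI)
    fix z z' :: "nat \<times> nat \<times> nat \<Rightarrow> 'f"
    assume z: "z \<in> I \<rightarrow>\<^sub>E UNIV" "z' \<in> I \<rightarrow>\<^sub>E UNIV" and eq: "restrict (\<Psi> z) J = restrict (\<Psi> z') J"
    have "\<Psi> (\<lambda>q. z q - z' q) q = 0" if "q \<in> J" for q
    proof -
      obtain a i l where q: "q = (a, i, l)" "i < m"
        using \<open>q \<in> J\<close> by (auto simp: J_def)
      have "\<Psi> z q = \<Psi> z' q"
        using fun_cong[OF eq, of q] that by simp
      then show ?thesis
        using \<Psi>_diff q by simp
    qed
    then have *: "ext a (\<lambda>q. z q - z' q) i l = 0" if "a < 3" "i < m" "l < k" for a i l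
      using kernel that by blast
    have "z (a, i, l) = z' (a, i, l)" if "(a, i, l) \<in> I" for a i l
      using *[of a i l] that by (simp add: I_def ext_def)
    then show "z = z'"
      by (intro PiE_ext[OF z]) auto
  qed
  moreover have "(\<lambda>z. restrict (\<Psi> z) J) ` (I \<rightarrow>\<^sub>E UNIV) \<subseteq> (J \<rightarrow>\<^sub>E (UNIV :: 'f set))"
    by auto
  moreover have fin: "finite I" "finite J"
    by (auto simp: I_def J_def)
  ultimately have "card (I \<rightarrow>\<^sub>E (UNIV :: 'f set)) \<le> card (J \<rightarrow>\<^sub>E (UNIV :: 'f set))"
    by (intro card_inj_on_le[where f = "\<lambda>z. restrict (\<Psi> z) J"] finite_PiE) auto
  then have "CARD('f) ^ card I \<le> CARD('f) ^ card J"
    using fin by (simp add: card_PiE)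
  moreover have "1 < CARD('f)"
    using card_mono[of UNIV "{0, 1::'f}"] by simp
  ultimately have "card I \<le> card J"
    using power_le_imp_le_exp by blast
  moreover have "card J = (m - 1) * n + 2 * (m * n)"
    unfolding J_def by (subst card_Un_disjoint) (auto simp: card_cartesian_product)
  moreover have "(m - 1) * n + 2 * (m * n) = (3 * m - 1) * n"
    using m(2) by (cases m) (simp_all add: algebra_simps)
  ultimately show ?thesis
    by (simp add: I_def card_cartesian_product)
qed

text \<open>
  A generalization of the non-Fano network.  Message j enters at node 0 j and reaches the tail node 1 i of
  every bottleneck i \<open>\<noteq>\<close> j, where i \<open>\<le>\<close> m.  Receiver r < m sees the bottlenecks r and m and
  demands message r; receiver m sees all bottlenecks but m and demands message 0.
  Nodes are pairs (layer, index) and arcs are pairs (tail, head), encoded as natural numbers.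
\<close>

definition node :: "nat \<Rightarrow> nat \<Rightarrow> nat" where
  "node a i = prod_encode (a, i)"

definition arc :: "nat \<Rightarrow> nat \<Rightarrow> nat" where
  "arc u v = prod_encode (u, v)"

definition sees :: "nat \<Rightarrow> nat \<Rightarrow> nat \<Rightarrow> bool" where
  "sees m r i \<longleftrightarrow> (if r = m then i < m else i = r \<or> i = m)"

definition bottleneck_arcs :: "nat \<Rightarrow> nat set" where
  "bottleneck_arcs m =
     {arc (node 0 j) (node (Suc 0) i) | i j. j < m \<and> i \<le> m \<and> j \<noteq> i} \<union>
     {arc (node (Suc 0) i) (node 2 i) | i. i \<le> m} \<union>
     {arc (node 2 i) (node 3 r) | i r. i \<le> m \<and> r \<le> m \<and> sees m r i}"

text \<open>The arc from layer 1 to layer 2 is the bottleneck proper: everything the receivers learn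
  about its inputs passes through its \<open>n\<close> symbols. Reduction modulo \<open>m\<close> in
  the demand turns receiver \<open>m\<close> into one that asks for message 0.\<close>

definition bottleneck_network :: "nat \<Rightarrow> (nat, nat) network" where
  "bottleneck_network m =
     \<lparr>graph = \<lparr>verts = {node a i | a i. a < 4 \<and> i \<le> m}, arcs = bottleneck_arcs m,
        tail = \<lambda>e. fst (prod_decode e), head = \<lambda>e. snd (prod_decode e)\<rparr>,
      sources = node 0 ` {..<m}, receivers = node 3 ` {..m}, num_msgs = m, origin = node 0,
      demand = \<lambda>v. {snd (prod_decode v) mod m}\<rparr>"

lemma node_eq_iff [simp]: "node a i = node b j \<longleftrightarrow> a = b \<and> i = j"
  by (simp add: node_def)

lemma arc_eq_iff [simp]: "arc u v = arc u' v' \<longleftrightarrow> u = u' \<and> v = v'"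
  by (simp add: arc_def)

lemma fst_prod_decode_arc [simp]: "fst (prod_decode (arc u v)) = u"
  by (simp add: arc_def)

lemma fst_prod_decode_node [simp]: "fst (prod_decode (node a i)) = a"
  by (simp add: node_def)

lemma bottleneck_network_simps [simp]:
  "num_msgs (bottleneck_network m) = m"
  "origin (bottleneck_network m) = node 0"
  "receivers (bottleneck_network m) = node 3 ` {..m}"
  "demand (bottleneck_network m) (node a i) = {i mod m}"
  "arcs (graph (bottleneck_network m)) = bottleneck_arcs m"
  "tail (graph (bottleneck_network m)) (arc u v) = u"
  "head (graph (bottleneck_network m)) (arc u v) = v"
  by (simp_all add: bottleneck_network_def arc_def node_def)

lemma bottleneck_arcs_cases:
  assumes "e \<in> bottleneck_arcs m"
  obtains i j where "e = arc (node 0 j) (node (Suc 0) i)" "j < m" "i \<le> m" "j \<noteq> i"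
  | i where "e = arc (node (Suc 0) i) (node 2 i)" "i \<le> m"
  | i r where "e = arc (node 2 i) (node 3 r)" "i \<le> m" "r \<le> m" "sees m r i"
  using assms unfolding bottleneck_arcs_def by blast

lemma bottleneck_arcsI:
  "j < m \<Longrightarrow> i \<le> m \<Longrightarrow> j \<noteq> i \<Longrightarrow> arc (node 0 j) (node (Suc 0) i) \<in> bottleneck_arcs m"
  "i \<le> m \<Longrightarrow> arc (node (Suc 0) i) (node 2 i) \<in> bottleneck_arcs m"
  "i \<le> m \<Longrightarrow> r \<le> m \<Longrightarrow> sees m r i \<Longrightarrow> arc (node 2 i) (node 3 r) \<in> bottleneck_arcs m"
  unfolding bottleneck_arcs_def by blast+

lemma bottleneck_inputs:
  "j < m \<Longrightarrow> inputs (bottleneck_network m) (node 0 j) = {Msg j}"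
  "i \<le> m \<Longrightarrow> inputs (bottleneck_network m) (node (Suc 0) i)
     = (\<lambda>j. Arc (arc (node 0 j) (node (Suc 0) i))) ` ({..<m} - {i})"
  "i \<le> m \<Longrightarrow> inputs (bottleneck_network m) (node 2 i) = {Arc (arc (node (Suc 0) i) (node 2 i))}"
  "r \<le> m \<Longrightarrow> inputs (bottleneck_network m) (node 3 r)
     = (\<lambda>i. Arc (arc (node 2 i) (node 3 r))) ` {i. i \<le> m \<and> sees m r i}"
  by (auto simp: inputs_def intro: bottleneck_arcsI elim!: bottleneck_arcs_cases)

text \<open>Every arc leads to a higher layer, so the layer is a measure excluding cycles.\<close>

lemma is_network_bottleneck:
  assumes "m > 0"
  shows "is_network (bottleneck_network m)"
proof -
  let ?G = "graph (bottleneck_network m)"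
  have verts: "verts ?G = {node a i | a i. a < 4 \<and> i \<le> m}"
    by (simp add: bottleneck_network_def)
  have "verts ?G = (\<lambda>(a, i). node a i) ` ({..<4} \<times> {..m})"
    by (auto simp: verts)
  then have finv: "finite (verts ?G)"
    by simp
  have ends: "tail ?G e \<in> verts ?G \<and> head ?G e \<in> verts ?G" if "e \<in> arcs ?G" for e
    using that by (auto simp: verts elim!: bottleneck_arcs_cases)
  have "arcs ?G \<subseteq> (\<lambda>(u, v). arc u v) ` (verts ?G \<times> verts ?G)"
  proof
    fix e assume "e \<in> arcs ?G"
    moreover have "e = arc (tail ?G e) (head ?G e)"
      by (simp add: bottleneck_network_def arc_def)
    ultimately show "e \<in> (\<lambda>(u, v). arc u v) ` (verts ?G \<times> verts ?G)"
      using ends[of e] by (intro image_eqI[of _ _ "(tail ?G e, head ?G e)"]) auto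
  qed
  then have "finite (arcs ?G)"
    by (rule finite_subset) (use finv in simp)
  then have "fin_digraph ?G"
    using finv ends by unfold_locales auto
  moreover have "acyclic (arcs_ends ?G)"
  proof -
    have "arcs_ends ?G \<subseteq> measure (\<lambda>v. fst (prod_decode v))"
      by (auto simp: arcs_ends_conv elim!: bottleneck_arcs_cases)
    then show ?thesis
      using acyclic_subset wf_acyclic[OF wf_measure] by blast
  qed
  moreover have "sources (bottleneck_network m) = node 0 ` {..<m}"
    by (simp add: bottleneck_network_def)
  ultimately show ?thesis
    using assms by (auto simp: is_network_def verts)
qed

section \<open>Rates of the generalized non-Fano network over R and over F\<close>

lemma bottleneck_solvable:
  assumes m: "m \<ge> 2" and u: "u * of_nat (m - 1) = (1::'r::{ring_1, finite})"
  shows "linearly_achievable (bottleneck_network m) TYPE('r) (replicate m 1)"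
proof -
  let ?N = "bottleneck_network m"
  \<comment> \<open>Nodes before the receivers add their inputs. Receiver r < \<open>m\<close>
    subtracts bottleneck r from bottleneck \<open>m\<close>. Receiver \<open>m\<close> forms
    \<open>u\<close> times the sum of its inputs and subtracts bottleneck 0 once, whence the weight
    \<open>u - 1\<close>.\<close>
  define q where "q v c = (if fst (prod_decode v) < 3 then 1
      else if v = node 3 m then (if c = Arc (arc (node 2 0) v) then u - 1 else u)
      else (if c = Arc (arc (node 2 m) v) then 1 else - 1))" for v and c :: "nat channel"
  define f where "f v x = [\<Sum>c\<in>inputs ?N v. q v c * (x c ! 0)]" for v and x :: "nat channel \<Rightarrow> 'r list"
  define C :: "(nat, nat, 'r) code"
    where "C = \<lparr>edge_fun = \<lambda>e. f (fst (prod_decode e)), decode_fun = \<lambda>v i. f v\<rparr>"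
  have bs: "block_size (\<lambda>_. 1) 1 c = 1" for c :: "nat channel"
    by (cases c) auto
  have lin: "two_sided_linear_map ?N (\<lambda>_. 1) 1 v 1 (f v)" for v
    unfolding two_sided_linear_map_def bs
    by (intro allI impI exI[of _ "\<lambda>_ _. 1 :: nat"] exI[of _ "\<lambda>c _ _. q v c"] exI[of _ "\<lambda>_ _ _. 1"])
       (simp add: f_def)
  have code: "is_code ?N (\<lambda>_. 1) 1 C"
    by (simp add: is_code_def C_def vecs_def f_def)
  have "two_sided_linear_code ?N (\<lambda>_. 1) 1 C"
    using code lin unfolding two_sided_linear_code_def
    by (auto simp: C_def bottleneck_network_def)
  moreover have "is_solution ?N (\<lambda>_. 1) 1 C"
    unfolding is_solution_def
  proof (intro conjI code allI impI ballI)
    fix w v i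
    assume w: "(\<forall>i<num_msgs ?N. w (Msg i) \<in> vecs 1) \<and> propagates ?N C w"
      and "v \<in> receivers ?N" and "i \<in> demand ?N v"
    then obtain r where r: "v = node 3 r" "r \<le> m" "i = r mod m"
      by auto
    define y where "y j = w (Msg j) ! 0" for j
    define s where "s = (\<Sum>j<m. y j)"
    have edge: "w (Arc (arc u v)) = [\<Sum>c\<in>inputs ?N u. q u c * (w c ! 0)]"
      if "arc u v \<in> bottleneck_arcs m" for u v
      using w that by (simp add: propagates_def C_def f_def)
    have q1: "q (node a i) c = 1" if "a < 3" for a i c
      using that by (simp add: q_def)
    have e0: "w (Arc (arc (node 0 j) (node (Suc 0) i))) = [y j]" if "j < m" "i \<le> m" "j \<noteq> i" for i j
      using that by (simp add: edge bottleneck_arcsI bottleneck_inputs q1 y_def)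
    have e1: "w (Arc (arc (node (Suc 0) i) (node 2 i))) = [\<Sum>j\<in>{..<m} - {i}. y j]" if "i \<le> m" for i
      using that by (simp add: edge[of "node (Suc 0) i"] bottleneck_arcsI bottleneck_inputs q1 sum.reindex inj_on_def e0)
    have e2: "w (Arc (arc (node 2 i) (node 3 r))) ! 0 = (\<Sum>j\<in>{..<m} - {i}. y j)"
      if "i \<le> m" "r \<le> m" "sees m r i" for i r
      using that by (simp add: edge[of "node 2 i"] bottleneck_arcsI bottleneck_inputs q1 e1)
    have part: "(\<Sum>j\<in>{..<m} - {i}. y j) = s - y i" if "i < m" for i
      using that by (simp add: s_def sum_diff1)
    have full: "(\<Sum>j\<in>{..<m} - {m}. y j) = s"
      by (simp add: s_def)
    have "decode_fun C v i (restrict w (inputs ?N v)) = [\<Sum>c\<in>inputs ?N v. q v c * (w c ! 0)]"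
      by (simp add: C_def f_def)
    also have "(\<Sum>c\<in>inputs ?N v. q v c * (w c ! 0)) =
        (\<Sum>i | i \<le> m \<and> sees m r i. q v (Arc (arc (node 2 i) v)) * (\<Sum>j\<in>{..<m} - {i}. y j))"
      using r by (simp add: bottleneck_inputs sum.reindex inj_on_def e2)
    also have "\<dots> = y i"
    proof (cases "r = m")
      case True
      have "{i. i \<le> m \<and> sees m r i} = {..<m}"
        using True by (auto simp: sees_def)
      moreover have "q v (Arc (arc (node 2 i) v)) * (\<Sum>j\<in>{..<m} - {i}. y j)
          = u * (s - y i) - (if i = 0 then s - y 0 else 0)" if "i < m" for i
        using True r(1) part[OF that] by (simp add: q_def left_diff_distrib)
      ultimately have "(\<Sum>i | i \<le> m \<and> sees m r i. q v (Arc (arc (node 2 i) v)) * (\<Sum>j\<in>{..<m} - {i}. y j))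
          = (\<Sum>i<m. u * (s - y i)) - (s - y 0)"
        using m by (simp add: sum_subtractf)
      \<comment> \<open>Each message is omitted once among the \<open>m\<close> sums, so they add up
        to m - 1 times the full sum \<open>s\<close>.\<close>
      also have "(\<Sum>i<m. u * (s - y i)) = u * (of_nat m * s - s)"
        by (simp add: s_def sum_subtractf flip: sum_distrib_left)
      also have "of_nat m * s - s = of_nat (m - 1) * s"
        using m by (simp add: of_nat_diff left_diff_distrib)
      also have "u * (of_nat (m - 1) * s) = s"
        using u by (simp flip: mult.assoc)
      finally show ?thesis
        using True r(3) by simp
    next
      case False
      then have "{i. i \<le> m \<and> sees m r i} = {r, m}"
        using r(2) by (auto simp: sees_def)
      then show ?thesis
        using False r part[of r] full by (simp add: q_def)
    qed
    also have "[y i] = w (Msg i)"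
    proof -
      have "i < m"
        using r m by simp
      then have "length (w (Msg i)) = 1"
        using w by (simp add: vecs_def)
      then show ?thesis
        by (cases "w (Msg i)") (auto simp: y_def)
    qed
    finally show "decode_fun C v i (restrict w (inputs ?N v)) = w (Msg i)" .
  qed
  moreover have "rate_vector ?N (\<lambda>_. 1) 1 = replicate m 1"
    by (simp add: rate_vector_def map_replicate_const)
  ultimately show ?thesis
    unfolding linearly_achievable_def by (intro exI conjI) auto
qed

text \<open>A code supplies the hypotheses of \<open>bottleneck_bound\<close>: the topology gives
  locality, the receivers give the two decoding rules, and linearity gives compatibility with
  differences.\<close>

lemma bottleneck_rate_le:
  assumes m: "of_nat m = (1::'f::{ring_1, finite})" "m \<ge> 2"
    and ach: "linearly_achievable (bottleneck_network m) TYPE('f) (replicate m r)"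
  shows "of_rat r \<le> (1 - 1 / (3 * m) :: real)"
proof -
  let ?N = "bottleneck_network m"
  obtain k n and C :: "(nat, nat, 'f) code" where n: "n \<ge> 1"
    and C: "two_sided_linear_code ?N k n C" and sol: "is_solution ?N k n C"
    and rate: "rate_vector ?N k n = replicate m r"
    using ach unfolding linearly_achievable_def by blast
  have N: "is_network ?N"
    using m(2) by (intro is_network_bottleneck) simp
  have code: "is_code ?N k n C"
    using C by (simp add: two_sided_linear_code_def)
  have r: "of_nat (k i) / of_nat n = r" if "i < m" for i
    using arg_cong[OF rate, of "\<lambda>xs. xs ! i"] that by (simp add: rate_vector_def)
  have k: "k i = k 0" if "i < m" for i
  proof -
    have "of_nat (k i) / (of_nat n :: rat) = of_nat (k 0) / of_nat n"
      using r[OF that] r[of 0] m(2) by simp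
    then show ?thesis
      using n by simp
  qed
  \<comment> \<open>\<open>W x\<close> is the run of the code on the messages read off from
    \<open>x\<close>; entries of \<open>x\<close> beyond the message lengths are ignored.\<close>
  obtain W :: "(nat \<Rightarrow> nat \<Rightarrow> 'f) \<Rightarrow> nat channel \<Rightarrow> 'f list"
    where W_msg: "\<And>x i. W x (Msg i) = map (x i) [0..<k i]" and W: "\<And>x. propagates ?N C (W x)"
  proof -
    have "\<exists>w. (\<forall>i. w (Msg i) = map (x i) [0..<k i]) \<and> propagates ?N C w" for x
      by (rule ex_propagates[OF N])
    then show thesis
      using that by metis
  qed
  have W_vecs: "W x (Msg i) \<in> vecs (k i)" for x i
    by (simp add: W_msg vecs_def)
  have W_len: "length (W x (Arc e)) = n" if "e \<in> bottleneck_arcs m" for x e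
    using propagates_vecs[OF N code W W_vecs] that by (simp add: vecs_def)
  have edge: "W x (Arc e) = edge_fun C e (restrict (W x) (inputs ?N (tail (graph ?N) e)))"
    if "e \<in> bottleneck_arcs m" for x e
    using W[of x] that by (simp add: propagates_def)
  have W_diff: "W (\<lambda>j l. x j l - y j l) (Arc e) = map2 (-) (W x (Arc e)) (W y (Arc e))"
    if "e \<in> bottleneck_arcs m" for x y e
  proof (rule propagates_unique[OF N W propagates_diff[OF N C W W_vecs W W_vecs]])
    show "W (\<lambda>j l. x j l - y j l) (Msg i) = map2 (-) (W x (Msg i)) (W y (Msg i))" for i
      by (rule nth_equalityI) (auto simp: W_msg)
  qed (use that in simp)
  define b where "b i = arc (node (Suc 0) i) (node 2 i)" for i
  \<comment> \<open>Padding by 0 beyond \<open>n\<close> lets vectors on the bottleneck be added and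
    compared as functions.\<close>
  define G where "G i x = (\<lambda>l. if l < n then W x (Arc (b i)) ! l else 0)" for i x
  have b: "b i \<in> bottleneck_arcs m" if "i \<le> m" for i
    using that by (simp add: b_def bottleneck_arcsI)
  have diff: "G i (\<lambda>j l. x j l - y j l) = (\<lambda>l. G i x l - G i y l)" if "i \<le> m" for i x y
    using W_len[OF b[OF that]] W_diff[OF b[OF that]] by (auto simp: G_def fun_eq_iff)
  have G_zero: "G i (\<lambda>_ _. 0) = (\<lambda>_. 0)" if "i \<le> m" for i
    using diff[OF that, of "\<lambda>_ _. 0" "\<lambda>_ _. 0"] by simp
  \<comment> \<open>If its bottlenecks carry 0, a receiver has the same inputs as in the run on zero
    messages, so it decodes the same message.\<close>
  have dec: "x (r mod m) l = 0"
    if G0: "\<And>i. i \<le> m \<Longrightarrow> sees m r i \<Longrightarrow> G i x = (\<lambda>_. 0)" and r: "r \<le> m" and l: "l < k 0" for x r l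
  proof -
    let ?v = "node 3 r" and ?W0 = "W (\<lambda>_ _. 0)"
    have "W x (Arc (b i)) = ?W0 (Arc (b i))" if "i \<le> m" "sees m r i" for i
    proof (rule nth_equalityI)
      fix l assume "l < length (W x (Arc (b i)))"
      then have "l < n"
        using W_len b that by simp
      then show "W x (Arc (b i)) ! l = ?W0 (Arc (b i)) ! l"
        using fun_cong[OF G0[OF that], of l] fun_cong[OF G_zero[OF that(1)], of l] by (simp add: G_def)
    qed (use W_len b that in simp)
    then have "restrict (W x) (inputs ?N (node 2 i)) = restrict ?W0 (inputs ?N (node 2 i))"
      if "i \<le> m" "sees m r i" for i
      using that by (intro restrict_ext) (auto simp: bottleneck_inputs b_def)
    then have "W x (Arc (arc (node 2 i) ?v)) = ?W0 (Arc (arc (node 2 i) ?v))" if "i \<le> m" "sees m r i" for i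
      using edge[OF bottleneck_arcsI(3)[OF that(1) r that(2)]] that by simp
    then have "restrict (W x) (inputs ?N ?v) = restrict ?W0 (inputs ?N ?v)"
      using r by (intro restrict_ext) (auto simp: bottleneck_inputs)
    moreover have "decode_fun C ?v (r mod m) (restrict (W x) (inputs ?N ?v)) = W x (Msg (r mod m))" for x
      using r by (intro is_solutionD[OF sol W_vecs W]) auto
    ultimately have "W x (Msg (r mod m)) = ?W0 (Msg (r mod m))"
      by metis
    moreover have "l < k (r mod m)"
      using l k[of "r mod m"] m(2) by simp
    ultimately show ?thesis
      using arg_cong[of "W x (Msg (r mod m))" _ "\<lambda>xs. xs ! l"] by (simp add: W_msg)
  qed
  have "3 * m * k 0 \<le> (3 * m - 1) * n"
  proof (rule bottleneck_bound[OF m diff])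
    show "G i x l = 0" if "n \<le> l" for i x l
      using that by (simp add: G_def)
    show "G i x = G i y" if i: "i \<le> m" and eq: "\<And>j l. j < m \<Longrightarrow> j \<noteq> i \<Longrightarrow> l < k 0 \<Longrightarrow> x j l = y j l" for i x y
    proof -
      have "restrict (W x) (inputs ?N (node 0 j)) = restrict (W y) (inputs ?N (node 0 j))"
        if "j < m" "j \<noteq> i" for j
        using that eq k[OF that(1)] by (intro restrict_ext) (auto simp: bottleneck_inputs W_msg)
      then have "W x (Arc (arc (node 0 j) (node (Suc 0) i))) = W y (Arc (arc (node 0 j) (node (Suc 0) i)))"
        if "j < m" "j \<noteq> i" for j
        using edge[OF bottleneck_arcsI(1)[OF that(1) i that(2)]] that by simp
      then have "restrict (W x) (inputs ?N (node (Suc 0) i)) = restrict (W y) (inputs ?N (node (Suc 0) i))"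
        using i by (intro restrict_ext) (auto simp: bottleneck_inputs)
      then have "W x (Arc (b i)) = W y (Arc (b i))"
        using edge[OF b[OF i]] by (simp add: b_def)
      then show ?thesis
        by (simp add: G_def cong: if_cong)
    qed
    show "x i l = 0" if "i < m" "G i x = (\<lambda>_. 0)" "G m x = (\<lambda>_. 0)" "l < k 0" for i x l
      using dec[of i x l] that by (auto simp: sees_def)
    show "x 0 l = 0" if "\<And>i. i < m \<Longrightarrow> G i x = (\<lambda>_. 0)" "l < k 0" for x l
      using dec[of m x l] that by (auto simp: sees_def)
  qed
  then have "real (3 * m * k 0) \<le> real ((3 * m - 1) * n)"
    by (simp only: of_nat_le_iff)
  then have "3 * real m * real (k 0) \<le> (3 * real m - 1) * real n"
    using m(2) by (simp add: of_nat_diff)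
  moreover have "of_rat r = real (k 0) / real n"
    using r[of 0] m(2) by (metis of_rat_divide of_rat_of_nat_eq less_le_trans zero_less_numeral)
  then have "real (k 0) = real n * of_rat r"
    using n by simp
  ultimately have "real n * (3 * real m * of_rat r) \<le> real n * (3 * real m - 1)"
    by (simp add: algebra_simps)
  then have "3 * real m * of_rat r \<le> 3 * real m - 1"
    using n by (simp add: mult_le_cancel_left)
  then show ?thesis
    using m(2) by (simp add: field_simps)
qed

theorem theorem4p5:
  shows "coprime CARD('f::{field, finite}) CARD('r::{ring_1, finite}) \<longleftrightarrow>
    (\<exists>N :: (nat, nat) network. is_network N \<and>
       lin_capacity N TYPE('r) > lin_capacity N TYPE('f))"
proof
  assume coprime: "coprime CARD('f) CARD('r)"
  define m where "m = CARD('f) + 1"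
  let ?N = "bottleneck_network m"
  have m: "of_nat m = (1::'f)" "m \<ge> 2"
    by (auto simp: m_def of_nat_CARD_eq_0 Suc_le_eq)
  have "lin_capacity ?N TYPE('f) \<le> ereal (1 - 1 / (3 * m))"
    unfolding lin_capacity_def
    by (rule SUP_least) (use bottleneck_rate_le[OF m] in simp)
  also have "\<dots> < 1"
    using m(2) by (simp add: one_ereal_def)
  also have "1 \<le> lin_capacity ?N TYPE('r)"
  proof -
    \<comment> \<open>A Bezout relation; since |R| vanishes in R, it makes \<open>u\<close> an
      inverse of |F| there.\<close>
    obtain u where "[CARD('f) * u = 1] (mod CARD('r))"
      using cong_solve_coprime_nat[OF coprime] by auto
    then obtain a b where "CARD('f) * u + a * CARD('r) = 1 + b * CARD('r)"
      by (metis cong_iff_lin_nat mult.commute)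
    then have "of_nat (CARD('f) * u + a * CARD('r)) = (of_nat (1 + b * CARD('r)) :: 'r)"
      by simp
    then have "of_nat (CARD('f) * u) = (1::'r)"
      by (simp add: of_nat_CARD_eq_0)
    then have "of_nat u * of_nat (m - 1) = (1::'r)"
      by (simp only: m_def diff_add_inverse2 mult.commute[of "CARD('f)"] of_nat_mult)
    from bottleneck_solvable[OF m(2) this]
    have "ereal (of_rat 1) \<le> lin_capacity ?N TYPE('r)"
      unfolding lin_capacity_def by (intro SUP_upper) simp
    then show ?thesis
      by (simp add: one_ereal_def)
  qed
  finally show "\<exists>N :: (nat, nat) network. is_network N \<and>
      lin_capacity N TYPE('r) > lin_capacity N TYPE('f)"
    using is_network_bottleneck[of m] m(2) by auto
next
  assume "\<exists>N :: (nat, nat) network. is_network N \<and>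
      lin_capacity N TYPE('r) > lin_capacity N TYPE('f)"
  then obtain N :: "(nat, nat) network" where N: "is_network N"
    "\<not> lin_capacity N TYPE('r) \<le> lin_capacity N TYPE('f)"
    by (auto simp: not_le)
  show "coprime CARD('f) CARD('r)"
  proof (rule ccontr)
    assume "\<not> coprime CARD('f) CARD('r)"
    then obtain p where "prime p" "p dvd gcd CARD('f) CARD('r)"
      using prime_factor_nat[of "gcd CARD('f) CARD('r)"] by (auto simp: coprime_iff_gcd_eq_1)
    then have "prime p" "p dvd CARD('f)" "p dvd CARD('r)"
      by simp_all
    then show False
      using lin_capacity_mono_common_prime[OF N(1)] N(2) by blast
  qed
qed

end
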